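(* Let $\Gamma$ be a connected graph with vertex set $V$, regarded as the coarse space $(V,\mathcal{E}_d)$, where $d$ is the path metric on $V$. Then the following statements are equivalent: (i) $\Gamma$ admits a bornologous selector; (ii) $\Gamma$ admits a 2-selector; (iii) $\Gamma$ is either bounded, or coarsely equivalent to $\mathbb{N}$ or to $\mathbb{Z}$.
   Context: Coarse structures. A family $\mathcal{E}$ of subsets of $X\times X$ is a coarse structure on a set $X$ if: each $E\in\mathcal{E}$ contains the diagonal $\triangle_X=\{(x,x):x\in X\}$; if $E,E'\in\mathcal{E}$ then $E\circ E'\in\mathcal{E}$ and $E^{-1}\in\mathcal{E}$, where $E\circ E'=\{(x,y):\exists z\,((x,z)\in E,\ (z,y)\in E')\}$ and $E^{-1}=\{(y,x):(x,y)\in E\}$; and if $E\in\mathcal{E}$ and $\triangle_X\subseteq E'\subseteq E$ then $E'\in\mathcal{E}$. The pair $(X,\mathcal{E})$ is called a coarse space. For $E\in\mathcal{E}$, $x\in X$, $Y\subseteq X$ put $E[x]=\{y\in X:(x,y)\in E\}$ and $E[Y]=\bigcup_{y\in Y}E[y]$. A subfamily $\mathcal{E}'\subseteq\mathcal{E}$ is a base of $\mathcal{E}$ if each $E\in\mathcal{E}$ is contained in some $E'\in\mathcal{E}'$. A subset $Y\subseteq X$ is bounded if $Y\subseteq E[x]$ for some $E\in\mathcal{E}$ and $x\in X$; the family of all bounded subsets of $X$ is denoted $\mathcal{B}_X$. The space is bounded if $X$ itself is a bounded subset, and unbounded otherwise. Each $Y\subseteq X$ carries the subspace coarse structure $\mathcal{E}|_Y=\{E\cap(Y\times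 Y):E\in\mathcal{E}\}$. The subspace $Y$ is large if $X=E[Y]$ for some $E\in\mathcal{E}$. Maps. A map $f:X\to X'$ between coarse spaces $(X,\mathcal{E})$, $(X',\mathcal{E}')$ is macro-uniform if for every $E\in\mathcal{E}$ there exists $E'\in\mathcal{E}'$ such that $f(E[x])\subseteq E'[f(x)]$ for each $x\in X$. An asymorphism is a bijection $f$ such that $f$ and $f^{-1}$ are macro-uniform. Two coarse spaces are coarsely equivalent if they contain large subspaces that are asymorphic to each other. Selectors. For a coarse space $(X,\mathcal{E})$, let $\exp X$ be the set of all non-empty subsets of $X$, endowed with the coarse structure having base $\{\exp E:E\in\mathcal{E}\}$, where $(A,B)\in\exp E$ if and only if $A\subseteq E[B]$ and $B\subseteq E[A]$. For a family $\mathcal{F}\subseteq\exp X$, endowed with the subspace coarse structure, an $\mathcal{F}$-selector of $(X,\mathcal{E})$ is a macro-uniform map $f:\mathcal{F}\to X$ such that $f(A)\in A$ for each $A\in\mathcal{F}$. A bornologous selector is an $\mathcal{F}$-selector with $\mathcal{F}=\mathcal{B}_X\setminus\{\emptyset\}$ (all non-empty bounded subsets). A 2-selector is an $\mathcal{F}$-selector with $\mathcal{F}=[X]^2$, the set of all two-element subsets of $X$ (if $X$ has only one point, the empty map counts as a 2-selector). Metrics and graphs. A metric $d$ on $X$ defines the coarse structure $\mathcal{E}_d$ with base $\{\{(x,y):d(x,y)\le r\}:r>0\}$. A connected graph (with non-empty vertex set) is regarded as a coarse space via the path metric on its vertices. No local finiteness is assumed. $\mathbb{N}$ and $\mathbb{Z}$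 denote the graphs on the sets of natural numbers and of integers, respectively, in which two vertices $a,b$ are adjacent if and only if $|a-b|=1$. *)

theory Defs
  imports "HOL-Analysis.Abstract_Metric_Spaces"
begin

text \<open>
  A coarse space is a pair of a carrier \<open>X :: 'a set\<close> and a family \<open>\<E>\<close> of relations on \<open>X\<close>.
  With \<open>E[x] = {y. (x, y) \<in> E}\<close>, the ball \<open>E[x]\<close> is the relational image \<open>E `` {x}\<close>,
  and \<open>E[Y]\<close> is \<open>E `` Y\<close>; the composition of entourages is \<open>E O E'\<close>.
\<close>

definition coarse_structure :: "'a set \<Rightarrow> ('a \<times> 'a) set set \<Rightarrow> bool" where
  "coarse_structure X \<E> \<longleftrightarrow>
     (\<forall>E\<in>\<E>. E \<subseteq> X \<times> X \<and> Id_on X \<subseteq> E) \<and>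
     (\<forall>E\<in>\<E>. \<forall>E'\<in>\<E>. E O E' \<in> \<E>) \<and>
     (\<forall>E\<in>\<E>. E\<inverse> \<in> \<E>) \<and>
     (\<forall>E\<in>\<E>. \<forall>E'. Id_on X \<subseteq> E' \<and> E' \<subseteq> E \<longrightarrow> E' \<in> \<E>)"

definition coarse_base :: "('a \<times> 'a) set set \<Rightarrow> ('a \<times> 'a) set set \<Rightarrow> bool" where
  "coarse_base \<E> \<B> \<longleftrightarrow> \<B> \<subseteq> \<E> \<and> (\<forall>E\<in>\<E>. \<exists>B\<in>\<B>. E \<subseteq> B)"

text \<open>
  The coarse structure with a given base; by \<open>coarse_of_base_unique\<close> below it is the only
  coarse structure having that base.
\<close>

definition coarse_of_base :: "'a set \<Rightarrow> ('a \<times> 'a) set set \<Rightarrow> ('a \<times> 'a) set set" where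
  "coarse_of_base X \<B> = {E. Id_on X \<subseteq> E \<and> (\<exists>B\<in>\<B>. E \<subseteq> B)}"

definition coarse_subspace :: "('a \<times> 'a) set set \<Rightarrow> 'a set \<Rightarrow> ('a \<times> 'a) set set" where
  "coarse_subspace \<E> Y = {E \<inter> Y \<times> Y |E. E \<in> \<E>}"

definition coarse_bounded :: "'a set \<Rightarrow> ('a \<times> 'a) set set \<Rightarrow> 'a set \<Rightarrow> bool" where
  "coarse_bounded X \<E> Y \<longleftrightarrow> Y \<subseteq> X \<and> (\<exists>E\<in>\<E>. \<exists>x\<in>X. Y \<subseteq> E `` {x})"

definition coarse_large :: "'a set \<Rightarrow> ('a \<times> 'a) set set \<Rightarrow> 'a set \<Rightarrow> bool" where
  "coarse_large X \<E> Y \<longleftrightarrow> Y \<subseteq> X \<and> (\<exists>E\<in>\<E>. X = E `` Y)"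

definition macro_uniform ::
  "'a set \<Rightarrow> ('a \<times> 'a) set set \<Rightarrow> 'b set \<Rightarrow> ('b \<times> 'b) set set \<Rightarrow> ('a \<Rightarrow> 'b) \<Rightarrow> bool" where
  "macro_uniform X \<E> X' \<E>' f \<longleftrightarrow>
     f ` X \<subseteq> X' \<and>
     (\<forall>E\<in>\<E>. \<exists>E'\<in>\<E>'. \<forall>x\<in>X. f ` (E `` {x}) \<subseteq> E' `` {f x})"

definition asymorphism ::
  "'a set \<Rightarrow> ('a \<times> 'a) set set \<Rightarrow> 'b set \<Rightarrow> ('b \<times> 'b) set set \<Rightarrow> ('a \<Rightarrow> 'b) \<Rightarrow> bool" where
  "asymorphism X \<E> X' \<E>' f \<longleftrightarrow>
     bij_betw f X X' \<and> macro_uniform X \<E> X' \<E>' f \<and> macro_uniform X' \<E>' X \<E> (inv_into X f)"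

definition coarsely_equivalent ::
  "'a set \<Rightarrow> ('a \<times> 'a) set set \<Rightarrow> 'b set \<Rightarrow> ('b \<times> 'b) set set \<Rightarrow> bool" where
  "coarsely_equivalent X \<E> X' \<E>' \<longleftrightarrow>
     (\<exists>Y Y' f. coarse_large X \<E> Y \<and> coarse_large X' \<E>' Y' \<and>
        asymorphism Y (coarse_subspace \<E> Y) Y' (coarse_subspace \<E>' Y') f)"

definition nonempty_subsets :: "'a set \<Rightarrow> 'a set set" where
  "nonempty_subsets X = Pow X - {{}}"

definition exp_entourage :: "'a set \<Rightarrow> ('a \<times> 'a) set \<Rightarrow> ('a set \<times> 'a set) set" where
  "exp_entourage X E =
     {(A, B). A \<in> nonempty_subsets X \<and> B \<in> nonempty_subsets X \<and> A \<subseteq> E `` B \<and> B \<subseteq> E `` A}"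

definition exp_coarse ::
  "'a set \<Rightarrow> ('a \<times> 'a) set set \<Rightarrow> ('a set \<times> 'a set) set set" where
  "exp_coarse X \<E> = coarse_of_base (nonempty_subsets X) (exp_entourage X ` \<E>)"

definition coarse_selector ::
  "'a set \<Rightarrow> ('a \<times> 'a) set set \<Rightarrow> 'a set set \<Rightarrow> ('a set \<Rightarrow> 'a) \<Rightarrow> bool" where
  "coarse_selector X \<E> \<F> f \<longleftrightarrow>
     \<F> \<subseteq> nonempty_subsets X \<and>
     macro_uniform \<F> (coarse_subspace (exp_coarse X \<E>) \<F>) X \<E> f \<and>
     (\<forall>A\<in>\<F>. f A \<in> A)"

definition bornologous_selector ::
  "'a set \<Rightarrow> ('a \<times> 'a) set set \<Rightarrow> ('a set \<Rightarrow> 'a) \<Rightarrow> bool" where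
  "bornologous_selector X \<E> f \<longleftrightarrow> coarse_selector X \<E> ({A. coarse_bounded X \<E> A} - {{}}) f"

text \<open>
  If \<open>X\<close> is a singleton, the domain below is empty and every \<open>f\<close> is a 2-selector
  (for a nonempty family \<open>\<E>\<close>).
\<close>

definition two_selector ::
  "'a set \<Rightarrow> ('a \<times> 'a) set set \<Rightarrow> ('a set \<Rightarrow> 'a) \<Rightarrow> bool" where
  "two_selector X \<E> f \<longleftrightarrow> coarse_selector X \<E> {A. A \<subseteq> X \<and> card A = 2} f"

definition metric_coarse :: "'a set \<Rightarrow> ('a \<Rightarrow> 'a \<Rightarrow> real) \<Rightarrow> ('a \<times> 'a) set set" where
  "metric_coarse X d = coarse_of_base X {{(x, y). x \<in> X \<and> y \<in> X \<and> d x y \<le> r} |r. r > 0}"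

text \<open>
  A simple graph, possibly infinite and not locally finite, is a vertex set \<open>V\<close> with a
  symmetric irreflexive adjacency relation \<open>A\<close> on it. The walks of length \<open>n\<close> from \<open>x\<close> to \<open>y\<close>
  exist iff \<open>(x, y) \<in> A ^^ n\<close>. The minimum defining \<open>path_dist\<close> is only meaningful when
  \<open>x\<close> and \<open>y\<close> are joined by a walk.
\<close>

definition simple_graph :: "'a set \<Rightarrow> ('a \<times> 'a) set \<Rightarrow> bool" where
  "simple_graph V A \<longleftrightarrow> A \<subseteq> V \<times> V \<and> sym A \<and> irrefl A"

definition connected_graph :: "'a set \<Rightarrow> ('a \<times> 'a) set \<Rightarrow> bool" where
  "connected_graph V A \<longleftrightarrow> simple_graph V A \<and> V \<noteq> {} \<and> (\<forall>x\<in>V. \<forall>y\<in>V. (x, y) \<in> A\<^sup>*)"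

definition path_dist :: "('a \<times> 'a) set \<Rightarrow> 'a \<Rightarrow> 'a \<Rightarrow> real" where
  "path_dist A x y = real (LEAST n. (x, y) \<in> A ^^ n)"

definition graph_coarse :: "'a set \<Rightarrow> ('a \<times> 'a) set \<Rightarrow> ('a \<times> 'a) set set" where
  "graph_coarse V A = metric_coarse V (path_dist A)"

definition nat_line :: "(nat \<times> nat) set" where
  "nat_line = {(a, b). \<bar>int a - int b\<bar> = 1}"

definition int_line :: "(int \<times> int) set" where
  "int_line = {(a, b). \<bar>a - b\<bar> = 1}"


lemma coarse_structureI:
  assumes 1: "\<And>E. E \<in> \<E> \<Longrightarrow> E \<subseteq> X \<times> X \<and> Id_on X \<subseteq> E"
    and 2: "\<And>E E'. E \<in> \<E> \<Longrightarrow> E' \<in> \<E> \<Longrightarrow> E O E' \<in> \<E>"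
    and 3: "\<And>E. E \<in> \<E> \<Longrightarrow> E\<inverse> \<in> \<E>"
    and 4: "\<And>E E'. E \<in> \<E> \<Longrightarrow> Id_on X \<subseteq> E' \<Longrightarrow> E' \<subseteq> E \<Longrightarrow> E' \<in> \<E>"
  shows "coarse_structure X \<E>"
  unfolding coarse_structure_def
proof (intro conjI[of "\<forall>E\<in>\<E>. E \<subseteq> X \<times> X \<and> Id_on X \<subseteq> E"] conjI ballI allI impI)
  show "E' \<in> \<E>" if "E \<in> \<E>" "Id_on X \<subseteq> E' \<and> E' \<subseteq> E" for E E'
    by (rule 4[OF that(1)]) (use that(2) in simp_all)
qed (simp_all only: 1 2 3)

lemma coarse_structureD:
  assumes "coarse_structure X \<E>" "E \<in> \<E>"
  shows "E \<subseteq> X \<times> X" "Id_on X \<subseteq> E"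
    and "E' \<in> \<E> \<Longrightarrow> E O E' \<in> \<E>"
    and "E\<inverse> \<in> \<E>"
    and "Id_on X \<subseteq> E' \<Longrightarrow> E' \<subseteq> E \<Longrightarrow> E' \<in> \<E>"
proof -
  note c = assms(1)[unfolded coarse_structure_def]
  note c1 = conjunct1[OF c] and c2 = conjunct2[OF c]
  show "E \<subseteq> X \<times> X" "Id_on X \<subseteq> E" using bspec[OF c1 assms(2)] by simp_all
  show "E O E' \<in> \<E>" if "E' \<in> \<E>"
    by (rule bspec[OF bspec[OF conjunct1[OF c2] assms(2)] that])
  show "E\<inverse> \<in> \<E>"
    by (rule bspec[OF conjunct1[OF conjunct2[OF c2]] assms(2)])
  show "E' \<in> \<E>" if "Id_on X \<subseteq> E'" "E' \<subseteq> E"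
    by (rule mp[OF spec[OF bspec[OF conjunct2[OF conjunct2[OF c2]] assms(2)]] conjI[OF that]])
qed

lemma coarse_of_base_unique:
  assumes E: "coarse_structure X \<E>" and B: "coarse_base \<E> \<B>"
  shows "\<E> = coarse_of_base X \<B>"
proof (rule set_eqI)
  fix F
  show "F \<in> \<E> \<longleftrightarrow> F \<in> coarse_of_base X \<B>"
  proof
    assume F: "F \<in> \<E>"
    then have "\<exists>B\<in>\<B>. F \<subseteq> B" using B by (simp add: coarse_base_def)
    with coarse_structureD(2)[OF E F] show "F \<in> coarse_of_base X \<B>"
      by (simp add: coarse_of_base_def)
  next
    assume "F \<in> coarse_of_base X \<B>"
    then obtain C where C: "Id_on X \<subseteq> F" "C \<in> \<B>" "F \<subseteq> C" by (auto simp: coarse_of_base_def)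
    then have "C \<in> \<E>" using B by (auto simp: coarse_base_def)
    from coarse_structureD(5)[OF E this C(1,3)] show "F \<in> \<E>" .
  qed
qed

lemma coarse_structure_of_base:
  assumes sub: "\<And>B. B \<in> \<B> \<Longrightarrow> B \<subseteq> X \<times> X \<and> Id_on X \<subseteq> B"
    and comp: "\<And>B C. B \<in> \<B> \<Longrightarrow> C \<in> \<B> \<Longrightarrow> \<exists>D\<in>\<B>. B O C \<subseteq> D"
    and conv: "\<And>B. B \<in> \<B> \<Longrightarrow> \<exists>D\<in>\<B>. B\<inverse> \<subseteq> D"
  shows "coarse_structure X (coarse_of_base X \<B>)" "coarse_base (coarse_of_base X \<B>) \<B>"
proof -
  have "E O E' \<in> coarse_of_base X \<B>"
    if E: "E \<in> coarse_of_base X \<B>" "E' \<in> coarse_of_base X \<B>" for E E'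
  proof -
    obtain B C where B: "B \<in> \<B>" "E \<subseteq> B" "C \<in> \<B>" "E' \<subseteq> C"
      using E by (auto simp: coarse_of_base_def)
    obtain D where "D \<in> \<B>" "B O C \<subseteq> D" using comp[OF B(1,3)] by blast
    moreover have "E O E' \<subseteq> B O C" using B by blast
    moreover have "Id_on X \<subseteq> E O E'" using E unfolding coarse_of_base_def by blast
    ultimately show ?thesis unfolding coarse_of_base_def by blast
  qed
  moreover have "E\<inverse> \<in> coarse_of_base X \<B>" if E: "E \<in> coarse_of_base X \<B>" for E
  proof -
    obtain B where B: "B \<in> \<B>" "E \<subseteq> B" using E by (auto simp: coarse_of_base_def)
    obtain D where "D \<in> \<B>" "B\<inverse> \<subseteq> D" using conv[OF B(1)] by blast
    moreover have "E\<inverse> \<subseteq> B\<inverse>" using B by blast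
    moreover have "Id_on X \<subseteq> E\<inverse>" using E unfolding coarse_of_base_def by blast
    ultimately show ?thesis unfolding coarse_of_base_def by blast
  qed
  moreover have "E \<subseteq> X \<times> X \<and> Id_on X \<subseteq> E" if "E \<in> coarse_of_base X \<B>" for E
    using that sub unfolding coarse_of_base_def by blast
  moreover have "E' \<in> coarse_of_base X \<B>"
    if "E \<in> coarse_of_base X \<B>" "Id_on X \<subseteq> E'" "E' \<subseteq> E" for E E'
    using that unfolding coarse_of_base_def by blast
  ultimately show "coarse_structure X (coarse_of_base X \<B>)"
    by (intro coarse_structureI)
  show "coarse_base (coarse_of_base X \<B>) \<B>"
    using sub unfolding coarse_base_def coarse_of_base_def by blast
qed

lemma coarse_structure_metric:
  assumes "Metric_space X d"
  shows "coarse_structure X (metric_coarse X d)"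
  unfolding metric_coarse_def
proof (rule coarse_structure_of_base(1))
  interpret Metric_space X d by fact
  show "B \<subseteq> X \<times> X \<and> Id_on X \<subseteq> B"
    if "B \<in> {{(x, y). x \<in> X \<and> y \<in> X \<and> d x y \<le> r} |r. r > 0}" for B
    using that by auto
  show "\<exists>D\<in>{{(x, y). x \<in> X \<and> y \<in> X \<and> d x y \<le> r} |r. r > 0}. B\<inverse> \<subseteq> D"
    if B: "B \<in> {{(x, y). x \<in> X \<and> y \<in> X \<and> d x y \<le> r} |r. r > 0}" for B
    by (rule bexI[OF _ B]) (use B in \<open>auto simp: commute\<close>)
  show "\<exists>D\<in>{{(x, y). x \<in> X \<and> y \<in> X \<and> d x y \<le> r} |r. r > 0}. B O C \<subseteq> D"
    if B: "B \<in> {{(x, y). x \<in> X \<and> y \<in> X \<and> d x y \<le> r} |r. r > 0}"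
      and C: "C \<in> {{(x, y). x \<in> X \<and> y \<in> X \<and> d x y \<le> r} |r. r > 0}" for B C
  proof -
    obtain r s where rs: "r > 0" "s > 0" "B = {(x, y). x \<in> X \<and> y \<in> X \<and> d x y \<le> r}"
      "C = {(x, y). x \<in> X \<and> y \<in> X \<and> d x y \<le> s}" using B C by auto
    have "B O C \<subseteq> {(x, y). x \<in> X \<and> y \<in> X \<and> d x y \<le> r + s}"
    proof
      fix p assume "p \<in> B O C"
      then obtain x y z where p: "p = (x, z)" "x \<in> X" "y \<in> X" "z \<in> X" "d x y \<le> r" "d y z \<le> s"
        using rs by auto
      then show "p \<in> {(x, y). x \<in> X \<and> y \<in> X \<and> d x y \<le> r + s}"
        using triangle[of x y z] by auto
    qed
    moreover have "r + s > 0" using rs by simp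
    ultimately show ?thesis by blast
  qed
qed

lemma coarse_structure_subspace:
  assumes E: "coarse_structure X \<E>" and Y: "Y \<subseteq> X"
  shows "coarse_structure Y (coarse_subspace \<E> Y)"
proof -
  note D = coarse_structureD[OF E]
  have sub: "E' \<in> coarse_subspace \<E> Y"
    if E1: "E1 \<in> \<E>" and E': "Id_on Y \<subseteq> E'" "E' \<subseteq> E1 \<inter> Y \<times> Y" for E1 E'
  proof -
    have "E' \<union> Id_on X \<in> \<E>"
      by (rule D(5)[OF E1]) (use E' D(2)[OF E1] in auto)
    moreover have "E' = (E' \<union> Id_on X) \<inter> Y \<times> Y" using E' by auto
    ultimately show ?thesis unfolding coarse_subspace_def by (intro CollectI exI conjI)
  qed
  have mem: "\<exists>E1\<in>\<E>. F = E1 \<inter> Y \<times> Y" if "F \<in> coarse_subspace \<E> Y" for F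
    using that unfolding coarse_subspace_def by auto
  have diag: "Id_on Y \<subseteq> E1" if "E1 \<in> \<E>" for E1
    using D(2)[OF that] Y by auto
  show ?thesis
  proof (rule coarse_structureI)
    fix F assume F: "F \<in> coarse_subspace \<E> Y"
    obtain E1 where E1: "E1 \<in> \<E>" "F = E1 \<inter> Y \<times> Y" using mem[OF F] by auto
    show "F \<subseteq> Y \<times> Y \<and> Id_on Y \<subseteq> F" using diag[OF E1(1)] E1(2) by auto
    show "F\<inverse> \<in> coarse_subspace \<E> Y"
      by (rule sub[OF D(4)[OF E1(1)]]) (use diag[OF E1(1)] E1(2) in auto)
    show "F' \<in> coarse_subspace \<E> Y" if "Id_on Y \<subseteq> F'" "F' \<subseteq> F" for F'
      by (rule sub[OF E1(1)]) (use that E1(2) in auto)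
    fix F' assume F': "F' \<in> coarse_subspace \<E> Y"
    obtain E2 where E2: "E2 \<in> \<E>" "F' = E2 \<inter> Y \<times> Y" using mem[OF F'] by auto
    show "F O F' \<in> coarse_subspace \<E> Y"
    proof (rule sub[OF D(3)[OF E1(1) E2(1)]])
      show "Id_on Y \<subseteq> F O F'" using diag[OF E1(1)] diag[OF E2(1)] E1(2) E2(2) by auto
      show "F O F' \<subseteq> (E1 O E2) \<inter> Y \<times> Y" using E1(2) E2(2) by auto
    qed
  qed
qed

lemma coarse_structure_exp:
  assumes E: "coarse_structure X \<E>"
  shows "coarse_structure (nonempty_subsets X) (exp_coarse X \<E>)"
  unfolding exp_coarse_def
proof (rule coarse_structure_of_base(1))
  note D = coarse_structureD[OF E]
  fix B assume B: "B \<in> exp_entourage X ` \<E>"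
  obtain E1 where E1: "E1 \<in> \<E>" "B = exp_entourage X E1" using B by auto
  have "S \<subseteq> E1 `` S" if "S \<subseteq> X" for S using that D(2)[OF E1(1)] by auto
  then show "B \<subseteq> nonempty_subsets X \<times> nonempty_subsets X \<and> Id_on (nonempty_subsets X) \<subseteq> B"
    unfolding E1(2) exp_entourage_def by (auto simp: nonempty_subsets_def)
  show "\<exists>D\<in>exp_entourage X ` \<E>. B\<inverse> \<subseteq> D"
    by (rule bexI[OF _ B]) (auto simp: E1(2) exp_entourage_def)
  fix C assume C: "C \<in> exp_entourage X ` \<E>"
  obtain E2 where E2: "E2 \<in> \<E>" "C = exp_entourage X E2" using C by auto
  let ?F = "(E1 O E2) O (E2 O E1)"
  have F: "?F \<in> \<E>" by (intro D(3) E1(1) E2(1))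
  have comp: "G \<subseteq> G O H" "H \<subseteq> G O H" if "G \<in> \<E>" "H \<in> \<E>" for G H
  proof -
    have "G = G O Id_on X" "H = Id_on X O H"
      using D(1)[OF that(1)] D(1)[OF that(2)] by auto
    then show "G \<subseteq> G O H" "H \<subseteq> G O H"
      using relcomp_mono[OF order.refl D(2)[OF that(2)]] relcomp_mono[OF D(2)[OF that(1)] order.refl]
      by metis+
  qed
  have sub: "E1 O E2 \<subseteq> ?F" "E2 O E1 \<subseteq> ?F"
    by (intro comp D(3) E1(1) E2(1))+
  have "B O C \<subseteq> exp_entourage X ?F"
  proof
    fix p assume "p \<in> B O C"
    then obtain S T U where p: "p = (S, U)" "(S, T) \<in> B" "(T, U) \<in> C" by auto
    have "S \<subseteq> E1 `` T" "T \<subseteq> E2 `` U" "U \<subseteq> E2 `` T" "T \<subseteq> E1 `` S"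
      using p(2,3) unfolding E1(2) E2(2) exp_entourage_def by simp_all
    then have "S \<subseteq> E1 `` (E2 `` U)" "U \<subseteq> E2 `` (E1 `` S)"
      by (meson Image_mono order.refl order.trans)+
    then have "S \<subseteq> (E2 O E1) `` U" "U \<subseteq> (E1 O E2) `` S"
      by (simp_all only: relcomp_Image)
    then have "S \<subseteq> ?F `` U" "U \<subseteq> ?F `` S"
      using Image_mono[OF sub(2) order.refl] Image_mono[OF sub(1) order.refl]
      by (meson order.trans)+
    then show "p \<in> exp_entourage X ?F"
      using p unfolding E1(2) E2(2) exp_entourage_def by simp
  qed
  then show "\<exists>D\<in>exp_entourage X ` \<E>. B O C \<subseteq> D" by (rule bexI[OF _ imageI[OF F]])
qed

lemma connected_graph_relpow:
  assumes "connected_graph V A" "x \<in> V" "y \<in> V"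
  shows "\<exists>n. (x, y) \<in> A ^^ n"
  using assms unfolding connected_graph_def by (meson rtrancl_imp_relpow)

lemma path_dist_le:
  assumes "(x, y) \<in> A ^^ n" shows "path_dist A x y \<le> real n"
  unfolding path_dist_def using assms by (simp add: Least_le)

lemma Metric_space_path_dist:
  assumes G: "connected_graph V A"
  shows "Metric_space V (path_dist A)"
proof
  have "sym A" using G by (simp add: connected_graph_def simple_graph_def)
  then have conv: "(A ^^ n)\<inverse> = A ^^ n" for n
    by (induction n) (auto simp: converse_relcomp sym_conv_converse_eq relpow_commute)
  have att: "\<exists>n. path_dist A x y = real n \<and> (x, y) \<in> A ^^ n" if "x \<in> V" "y \<in> V" for x y
    using connected_graph_relpow[OF G that] unfolding path_dist_def by (metis LeastI_ex)
  show "0 \<le> path_dist A x y" for x y by (simp add: path_dist_def)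
  show "path_dist A x y = path_dist A y x" for x y
  proof -
    have "(x, y) \<in> A ^^ n \<longleftrightarrow> (y, x) \<in> A ^^ n" for n using conv[of n] by blast
    then show ?thesis by (simp add: path_dist_def)
  qed
  show "path_dist A x y = 0 \<longleftrightarrow> x = y" if "x \<in> V" "y \<in> V" for x y
  proof
    assume "path_dist A x y = 0"
    then show "x = y" using att[OF that] by auto
  next
    assume "x = y"
    then have "(x, y) \<in> A ^^ 0" by simp
    from path_dist_le[OF this] show "path_dist A x y = 0" by (simp add: path_dist_def)
  qed
  show "path_dist A x z \<le> path_dist A x y + path_dist A y z"
    if xyz: "x \<in> V" "y \<in> V" "z \<in> V" for x y z
  proof -
    obtain m n where mn: "path_dist A x y = real m" "(x, y) \<in> A ^^ m"
      "path_dist A y z = real n" "(y, z) \<in> A ^^ n"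
      using att[OF xyz(1,2)] att[OF xyz(2,3)] by blast
    then have "(x, z) \<in> A ^^ (m + n)" by (auto simp: relpow_add)
    from path_dist_le[OF this] show ?thesis using mn by simp
  qed
qed

lemma coarse_structure_graph:
  "connected_graph V A \<Longrightarrow> coarse_structure V (graph_coarse V A)"
  unfolding graph_coarse_def by (intro coarse_structure_metric Metric_space_path_dist)

lemma connected_graph_nat_line: "connected_graph UNIV nat_line"
proof -
  have s: "sym nat_line" by (auto simp: nat_line_def sym_def)
  have "(0, n) \<in> nat_line\<^sup>*" for n
    by (induction n) (auto simp: nat_line_def intro: rtrancl_into_rtrancl)
  then have "(x, y) \<in> nat_line\<^sup>*" for x y
    using s by (meson rtrancl_trans sym_rtrancl symD)
  then show ?thesis
    using s by (auto simp: connected_graph_def simple_graph_def irrefl_def nat_line_def)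
qed

lemma connected_graph_int_line: "connected_graph UNIV int_line"
proof -
  have s: "sym int_line" by (auto simp: int_line_def sym_def)
  have "(0, n) \<in> int_line\<^sup>*" for n
    by (induction n rule: int_induct[where k = 0])
      (auto simp: int_line_def intro: rtrancl_into_rtrancl)
  then have "(x, y) \<in> int_line\<^sup>*" for x y
    using s by (meson rtrancl_trans sym_rtrancl symD)
  then show ?thesis
    using s by (auto simp: connected_graph_def simple_graph_def irrefl_def int_line_def)
qed

end

theory Submission
  imports Defs
begin

text \<open>
  Every bounded set of integers has a least element, and this element depends on the set in a
  \<open>1\<close>-Lipschitz way with respect to the Hausdorff distance. A space that embeds coarsely into the
  integers therefore has a bornologous selector, taking a point of least image
  (\<open>bornologous_selector_if_coarse_embedding_int\<close>). Bounded spaces and spaces coarsely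
  equivalent to one of the two lines do embed in this way. A bornologous selector is in particular
  a selector on pairs.

  For the converse, a 2-selector \<open>f\<close> is used as a tournament, \<open>x\<close> before \<open>y\<close> meaning
  \<open>f {x, y} = y\<close>. Macro-uniformity for radius \<open>1\<close> gives a constant \<open>K\<close> such that the order of
  two points does not change while they move along edges at distance more than \<open>K\<close>
  from each other (\<open>two_selector_stable_on_far_pairs\<close>). So far-apart points cannot be swapped,
  which excludes large branchings and large cycles. This is made quantitative by a single function:
  fix a base point \<open>w\<close> and let \<open>h x\<close> be the distance from \<open>w\<close> to \<open>x\<close>, with sign telling whether
  \<open>w\<close> comes before or after \<open>x\<close>. Then \<open>h\<close> preserves distances up to the additive error \<open>2 * K\<close>
  (\<open>signed_dist_quasi_isometric\<close>):

  \<^item> If \<open>x\<close> and \<open>y\<close> have opposite signs, a geodesic between them must enter the ball of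
    radius \<open>K\<close> around \<open>w\<close>, because outside that ball the sign is constant along paths. So the
    distance of \<open>x\<close> and \<open>y\<close> is, up to \<open>2 * K\<close>, the sum of their distances from \<open>w\<close>.

  \<^item> If the signs agree but the distance of \<open>x\<close> and \<open>y\<close> exceeds the difference of their
    distances from \<open>w\<close> by more than \<open>2 * K\<close>, then a point travelling along a geodesic from \<open>w\<close>
    to \<open>x\<close> stays further than \<open>K\<close> from \<open>y\<close>, and symmetrically. Thus the pair \<open>{w, y}\<close> is
    ordered as \<open>{x, y}\<close>, and the pair \<open>{w, x}\<close> as \<open>{y, x}\<close>. Equal signs would then put \<open>x\<close> before
    \<open>y\<close> and \<open>y\<close> before \<open>x\<close>, or neither.

  It remains to look at the image of \<open>h\<close>, which leaves no large gaps because the graph is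
  connected. If \<open>h\<close> is unbounded in both directions, the graph is coarsely the integers; if in one
  direction only, the distance from \<open>w\<close> is already a coarse equivalence with the natural numbers;
  if in none, the graph is bounded.
\<close>

section \<open>Coarse notions in metric terms\<close>

text \<open>
  Coarse geometry of a single map is a comparison of two metrics on its domain: the given one and
  the one pulled back along the map.
\<close>

definition controlled :: "'a set \<Rightarrow> ('a \<Rightarrow> 'a \<Rightarrow> real) \<Rightarrow> ('a \<Rightarrow> 'a \<Rightarrow> real) \<Rightarrow> bool" where
  "controlled X d d' \<longleftrightarrow> (\<forall>r. \<exists>s. \<forall>x\<in>X. \<forall>y\<in>X. d x y \<le> r \<longrightarrow> d' x y \<le> s)"

definition coarse_embedding ::
  "'a set \<Rightarrow> ('a \<Rightarrow> 'a \<Rightarrow> real) \<Rightarrow> 'b set \<Rightarrow> ('b \<Rightarrow> 'b \<Rightarrow> real) \<Rightarrow> ('a \<Rightarrow> 'b) \<Rightarrow> bool" where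
  "coarse_embedding X d X' d' g \<longleftrightarrow> g ` X \<subseteq> X' \<and>
     controlled X d (\<lambda>x y. d' (g x) (g y)) \<and> controlled X (\<lambda>x y. d' (g x) (g y)) d"

definition hausdorff_close :: "('a \<Rightarrow> 'a \<Rightarrow> real) \<Rightarrow> real \<Rightarrow> 'a set \<Rightarrow> 'a set \<Rightarrow> bool" where
  "hausdorff_close d r A B \<longleftrightarrow> (\<forall>a\<in>A. \<exists>b\<in>B. d b a \<le> r) \<and> (\<forall>b\<in>B. \<exists>a\<in>A. d a b \<le> r)"

definition tube :: "'a set \<Rightarrow> ('a \<Rightarrow> 'a \<Rightarrow> real) \<Rightarrow> real \<Rightarrow> ('a \<times> 'a) set" where
  "tube X d r = {(x, y). x \<in> X \<and> y \<in> X \<and> d x y \<le> r}"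

lemma controlledD:
  "controlled X d d' \<Longrightarrow> \<exists>s. \<forall>x\<in>X. \<forall>y\<in>X. d x y \<le> r \<longrightarrow> d' x y \<le> s"
  unfolding controlled_def by (rule spec)

lemma controlled_additive:
  assumes "\<And>x y. x \<in> X \<Longrightarrow> y \<in> X \<Longrightarrow> d' x y \<le> d x y + c"
  shows "controlled X d d'"
  unfolding controlled_def
proof
  show "\<exists>s. \<forall>x\<in>X. \<forall>y\<in>X. d x y \<le> r \<longrightarrow> d' x y \<le> s" for r
    by (rule exI[of _ "r + c"]) (use assms in force)
qed

lemma metric_coarse_iff:
  "E \<in> metric_coarse X d \<longleftrightarrow>
     Id_on X \<subseteq> E \<and> E \<subseteq> X \<times> X \<and> (\<exists>r. \<forall>x y. (x, y) \<in> E \<longrightarrow> d x y \<le> r)"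
proof
  assume "E \<in> metric_coarse X d"
  then show "Id_on X \<subseteq> E \<and> E \<subseteq> X \<times> X \<and> (\<exists>r. \<forall>x y. (x, y) \<in> E \<longrightarrow> d x y \<le> r)"
    unfolding metric_coarse_def coarse_of_base_def by blast
next
  assume E: "Id_on X \<subseteq> E \<and> E \<subseteq> X \<times> X \<and> (\<exists>r. \<forall>x y. (x, y) \<in> E \<longrightarrow> d x y \<le> r)"
  then obtain r where r: "\<forall>x y. (x, y) \<in> E \<longrightarrow> d x y \<le> r" by blast
  have "E \<subseteq> {(x, y). x \<in> X \<and> y \<in> X \<and> d x y \<le> max r 1}"
    using E r by (auto simp: le_max_iff_disj)
  moreover have "max r 1 > 0" by simp
  ultimately show "E \<in> metric_coarse X d"
    using E unfolding metric_coarse_def coarse_of_base_def by blast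
qed

context Metric_space
begin

lemma tube_in_metric_coarse: "r \<ge> 0 \<Longrightarrow> tube M d r \<in> metric_coarse M d"
  unfolding metric_coarse_iff tube_def by (auto simp: Id_on_def)

lemma coarse_subspace_metric:
  assumes "Y \<subseteq> M"
  shows "coarse_subspace (metric_coarse M d) Y = metric_coarse Y d"
proof
  show "coarse_subspace (metric_coarse M d) Y \<subseteq> metric_coarse Y d"
    using assms unfolding coarse_subspace_def by (fastforce simp: metric_coarse_iff)
  show "metric_coarse Y d \<subseteq> coarse_subspace (metric_coarse M d) Y"
  proof
    fix E assume E: "E \<in> metric_coarse Y d"
    then obtain r where r: "\<forall>x y. (x, y) \<in> E \<longrightarrow> d x y \<le> r" by (auto simp: metric_coarse_iff)
    have "E \<union> Id_on M \<in> metric_coarse M d"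
      unfolding metric_coarse_iff
    proof (intro conjI exI allI impI)
      show "E \<union> Id_on M \<subseteq> M \<times> M" using E assms by (auto simp: metric_coarse_iff)
      show "d x y \<le> max r 0" if "(x, y) \<in> E \<union> Id_on M" for x y
        using that r by (auto simp: le_max_iff_disj)
    qed auto
    moreover have "E = (E \<union> Id_on M) \<inter> Y \<times> Y" using E by (auto simp: metric_coarse_iff)
    ultimately show "E \<in> coarse_subspace (metric_coarse M d) Y"
      unfolding coarse_subspace_def by blast
  qed
qed

lemma coarse_bounded_metric:
  "coarse_bounded M (metric_coarse M d) Y \<longleftrightarrow> Y \<subseteq> M \<and> (\<exists>x\<in>M. \<exists>r. \<forall>y\<in>Y. d x y \<le> r)"
proof
  assume "coarse_bounded M (metric_coarse M d) Y"
  then obtain E x where E: "Y \<subseteq> M" "E \<in> metric_coarse M d" "x \<in> M" "Y \<subseteq> E `` {x}"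
    unfolding coarse_bounded_def by blast
  then show "Y \<subseteq> M \<and> (\<exists>x\<in>M. \<exists>r. \<forall>y\<in>Y. d x y \<le> r)"
    unfolding metric_coarse_iff by blast
next
  assume Y: "Y \<subseteq> M \<and> (\<exists>x\<in>M. \<exists>r. \<forall>y\<in>Y. d x y \<le> r)"
  then obtain x r where x: "x \<in> M" "\<forall>y\<in>Y. d x y \<le> r" by blast
  have "Y \<subseteq> tube M d (max r 0) `` {x}"
    using x Y unfolding tube_def by (auto simp: le_max_iff_disj)
  then show "coarse_bounded M (metric_coarse M d) Y"
    unfolding coarse_bounded_def using x Y tube_in_metric_coarse[of "max r 0"] by auto
qed

lemma coarse_large_metric:
  "coarse_large M (metric_coarse M d) Y \<longleftrightarrow> Y \<subseteq> M \<and> (\<exists>r. \<forall>x\<in>M. \<exists>y\<in>Y. d y x \<le> r)"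
proof
  assume "coarse_large M (metric_coarse M d) Y"
  then obtain E where E: "Y \<subseteq> M" "E \<in> metric_coarse M d" "M = E `` Y"
    unfolding coarse_large_def by blast
  from E(2) obtain r where "\<And>x y. (x, y) \<in> E \<Longrightarrow> d x y \<le> r"
    unfolding metric_coarse_iff by blast
  with E(1,3) show "Y \<subseteq> M \<and> (\<exists>r. \<forall>x\<in>M. \<exists>y\<in>Y. d y x \<le> r)"
    by (metis ImageE)
next
  assume Y: "Y \<subseteq> M \<and> (\<exists>r. \<forall>x\<in>M. \<exists>y\<in>Y. d y x \<le> r)"
  then obtain r where r: "\<forall>x\<in>M. \<exists>y\<in>Y. d y x \<le> r" by blast
  have "M = tube M d (max r 0) `` Y"
  proof (intro equalityI subsetI)
    fix x assume x: "x \<in> M"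
    then obtain y where "y \<in> Y" "d y x \<le> r" using r by blast
    then show "x \<in> tube M d (max r 0) `` Y"
      using x Y unfolding tube_def by (auto simp: le_max_iff_disj)
  qed (auto simp: tube_def)
  then show "coarse_large M (metric_coarse M d) Y"
    unfolding coarse_large_def using Y tube_in_metric_coarse[of "max r 0"] by (auto intro!: bexI)
qed

end

lemma macro_uniform_metric:
  assumes "Metric_space X d" "Metric_space X' d'"
  shows "macro_uniform X (metric_coarse X d) X' (metric_coarse X' d') f \<longleftrightarrow>
           f ` X \<subseteq> X' \<and> controlled X d (\<lambda>x y. d' (f x) (f y))"
proof
  assume mu: "macro_uniform X (metric_coarse X d) X' (metric_coarse X' d') f"
  have "\<exists>s. \<forall>x\<in>X. \<forall>y\<in>X. d x y \<le> r \<longrightarrow> d' (f x) (f y) \<le> s" for r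
  proof -
    have "tube X d (max r 0) \<in> metric_coarse X d"
      using assms(1) by (simp add: Metric_space.tube_in_metric_coarse)
    then obtain E' where E': "E' \<in> metric_coarse X' d'"
      "\<And>x. x \<in> X \<Longrightarrow> f ` (tube X d (max r 0) `` {x}) \<subseteq> E' `` {f x}"
      using mu unfolding macro_uniform_def by meson
    obtain s where "\<forall>x y. (x, y) \<in> E' \<longrightarrow> d' x y \<le> s" using E'(1) by (auto simp: metric_coarse_iff)
    moreover have "(f x, f y) \<in> E'" if "x \<in> X" "y \<in> X" "d x y \<le> r" for x y
      using E'(2)[OF that(1)] that unfolding tube_def by (auto simp: le_max_iff_disj)
    ultimately show ?thesis by blast
  qed
  then show "f ` X \<subseteq> X' \<and> controlled X d (\<lambda>x y. d' (f x) (f y))"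
    using mu unfolding macro_uniform_def controlled_def by blast
next
  assume f: "f ` X \<subseteq> X' \<and> controlled X d (\<lambda>x y. d' (f x) (f y))"
  have "\<exists>E'\<in>metric_coarse X' d'. \<forall>x\<in>X. f ` (E `` {x}) \<subseteq> E' `` {f x}"
    if E: "E \<in> metric_coarse X d" for E
  proof -
    obtain r where r: "\<forall>x y. (x, y) \<in> E \<longrightarrow> d x y \<le> r" using E by (auto simp: metric_coarse_iff)
    obtain s where s: "\<forall>x\<in>X. \<forall>y\<in>X. d x y \<le> r \<longrightarrow> d' (f x) (f y) \<le> s"
      using controlledD[OF conjunct2[OF f], of r] by (rule exE)
    have "(f x, f y) \<in> tube X' d' (max s 0)" if "(x, y) \<in> E" for x y
    proof -
      have "x \<in> X" "y \<in> X" using E that by (auto simp: metric_coarse_iff)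
      then show ?thesis using s r that f unfolding tube_def by (auto simp: le_max_iff_disj)
    qed
    then have "\<forall>x\<in>X. f ` (E `` {x}) \<subseteq> tube X' d' (max s 0) `` {f x}" by blast
    then show ?thesis
      by (rule bexI) (simp add: Metric_space.tube_in_metric_coarse[OF assms(2)])
  qed
  then show "macro_uniform X (metric_coarse X d) X' (metric_coarse X' d') f"
    unfolding macro_uniform_def using f by blast
qed

lemma coarse_selector_metric:
  assumes "Metric_space X d"
  shows "coarse_selector X (metric_coarse X d) \<F> f \<longleftrightarrow>
           \<F> \<subseteq> nonempty_subsets X \<and> (\<forall>A\<in>\<F>. f A \<in> A) \<and>
           (\<forall>r. \<exists>s. \<forall>A\<in>\<F>. \<forall>B\<in>\<F>. hausdorff_close d r A B \<longrightarrow> d (f A) (f B) \<le> s)"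
    (is "?L \<longleftrightarrow> ?F \<and> ?S \<and> ?C")
proof
  interpret Metric_space X d by fact
  assume L: ?L
  then have F: ?F and S: ?S
    and mu: "macro_uniform \<F> (coarse_subspace (exp_coarse X (metric_coarse X d)) \<F>) X (metric_coarse X d) f"
    unfolding coarse_selector_def by auto
  have "\<exists>s. \<forall>A\<in>\<F>. \<forall>B\<in>\<F>. hausdorff_close d r A B \<longrightarrow> d (f A) (f B) \<le> s" for r
  proof -
    define T where "T = exp_entourage X (tube X d (max r 0))"
    have "(A, A) \<in> T" if "A \<in> nonempty_subsets X" for A
      using that unfolding T_def exp_entourage_def nonempty_subsets_def tube_def
      by (force simp: le_max_iff_disj)
    then have "Id_on (nonempty_subsets X) \<subseteq> T" by auto
    then have "T \<in> exp_coarse X (metric_coarse X d)"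
      unfolding exp_coarse_def coarse_of_base_def T_def
      using tube_in_metric_coarse[of "max r 0"] by auto
    then have "T \<inter> \<F> \<times> \<F> \<in> coarse_subspace (exp_coarse X (metric_coarse X d)) \<F>"
      unfolding coarse_subspace_def by blast
    then obtain E' where E': "E' \<in> metric_coarse X d"
      "\<And>A. A \<in> \<F> \<Longrightarrow> f ` ((T \<inter> \<F> \<times> \<F>) `` {A}) \<subseteq> E' `` {f A}"
      using mu unfolding macro_uniform_def by meson
    obtain s where s: "\<forall>x y. (x, y) \<in> E' \<longrightarrow> d x y \<le> s" using E'(1) by (auto simp: metric_coarse_iff)
    have "(f A, f B) \<in> E'" if AB: "A \<in> \<F>" "B \<in> \<F>" "hausdorff_close d r A B" for A B
    proof -
      have sub: "A \<subseteq> X" "B \<subseteq> X" using F AB unfolding nonempty_subsets_def by auto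
      have "A \<subseteq> tube X d (max r 0) `` B"
      proof
        fix a assume a: "a \<in> A"
        then obtain b where "b \<in> B" "d b a \<le> r" using AB(3) unfolding hausdorff_close_def by blast
        with a sub show "a \<in> tube X d (max r 0) `` B" unfolding tube_def by (auto simp: le_max_iff_disj)
      qed
      moreover have "B \<subseteq> tube X d (max r 0) `` A"
      proof
        fix b assume b: "b \<in> B"
        then obtain a where "a \<in> A" "d a b \<le> r" using AB(3) unfolding hausdorff_close_def by blast
        with b sub show "b \<in> tube X d (max r 0) `` A" unfolding tube_def by (auto simp: le_max_iff_disj)
      qed
      ultimately have "(A, B) \<in> T"
        using F AB unfolding T_def exp_entourage_def by auto
      then show ?thesis using E'(2)[OF AB(1)] AB by blast
    qed
    with s show ?thesis by blast
  qed
  with F S show "?F \<and> ?S \<and> ?C" by blast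
next
  interpret Metric_space X d by fact
  assume R: "?F \<and> ?S \<and> ?C"
  have fX: "f ` \<F> \<subseteq> X" using R unfolding nonempty_subsets_def by blast
  have "\<exists>E'\<in>metric_coarse X d. \<forall>A\<in>\<F>. f ` (E `` {A}) \<subseteq> E' `` {f A}"
    if E: "E \<in> coarse_subspace (exp_coarse X (metric_coarse X d)) \<F>" for E
  proof -
    obtain E0 where E0: "E0 \<in> metric_coarse X d" "E \<subseteq> exp_entourage X E0" "E \<subseteq> \<F> \<times> \<F>"
      using E unfolding coarse_subspace_def exp_coarse_def coarse_of_base_def by blast
    obtain r where r: "\<forall>x y. (x, y) \<in> E0 \<longrightarrow> d x y \<le> r" using E0(1) by (auto simp: metric_coarse_iff)
    obtain s where s: "\<forall>A\<in>\<F>. \<forall>B\<in>\<F>. hausdorff_close d r A B \<longrightarrow> d (f A) (f B) \<le> s"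
      using R by blast
    have "(f A, f B) \<in> tube X d (max s 0)" if AB: "(A, B) \<in> E" for A B
    proof -
      have "A \<subseteq> E0 `` B" "B \<subseteq> E0 `` A" using AB E0(2) unfolding exp_entourage_def by auto
      then have "hausdorff_close d r A B" unfolding hausdorff_close_def using r by blast
      moreover have F: "A \<in> \<F>" "B \<in> \<F>" using AB E0(3) by auto
      ultimately have "d (f A) (f B) \<le> s" using s by blast
      then show ?thesis using F fX unfolding tube_def by (auto simp: le_max_iff_disj)
    qed
    then have "\<forall>A\<in>\<F>. f ` (E `` {A}) \<subseteq> tube X d (max s 0) `` {f A}" by blast
    moreover have "tube X d (max s 0) \<in> metric_coarse X d" by (simp add: tube_in_metric_coarse)
    ultimately show ?thesis by (rule bexI)
  qed
  then have "macro_uniform \<F> (coarse_subspace (exp_coarse X (metric_coarse X d)) \<F>) X (metric_coarse X d) f"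
    using fX unfolding macro_uniform_def by simp
  then show ?L using R unfolding coarse_selector_def by simp
qed

section \<open>Coarse equivalences and coarse embeddings\<close>

text \<open>
  Coarse equivalence asks for a bijection between large subspaces. Distinct points with the same
  image under a coarse embedding are uniformly close, so one point chosen from each fibre gives a
  large subspace on which the embedding is injective.
\<close>

lemma coarsely_equivalent_if_dense_coarse_embedding:
  assumes X: "Metric_space X d" and X': "Metric_space X' d'"
    and h: "coarse_embedding X d X' d' h"
    and dense: "\<And>z. z \<in> X' \<Longrightarrow> \<exists>x\<in>X. d' (h x) z \<le> c"
  shows "coarsely_equivalent X (metric_coarse X d) X' (metric_coarse X' d')"
proof -
  interpret X: Metric_space X d by fact
  interpret X': Metric_space X' d' by fact
  have hX: "h ` X \<subseteq> X'" and up: "controlled X d (\<lambda>x y. d' (h x) (h y))"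
    and down: "controlled X (\<lambda>x y. d' (h x) (h y)) d"
    using h unfolding coarse_embedding_def by auto
  define Y where "Y = inv_into X h ` (h ` X)"
  have YX: "Y \<subseteq> X" unfolding Y_def by (auto intro: inv_into_into)
  have hY: "h ` Y = h ` X"
    unfolding Y_def image_image by (auto simp: f_inv_into_f intro!: image_eqI)
  have bij: "bij_betw h Y (h ` X)"
    unfolding bij_betw_def
  proof
    show "inj_on h Y" unfolding Y_def by (rule inj_onI) (auto simp: f_inv_into_f)
  qed (fact hY)
  have MY: "Metric_space Y d" using YX by (rule X.subspace)
  have MhX: "Metric_space (h ` X) d'" using hX by (rule X'.subspace)
  have "coarse_large X (metric_coarse X d) Y"
    unfolding X.coarse_large_metric
  proof
    obtain s where s: "\<forall>x\<in>X. \<forall>y\<in>X. d' (h x) (h y) \<le> 0 \<longrightarrow> d x y \<le> s"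
      using controlledD[OF down, of 0] by (rule exE)
    have "\<exists>y\<in>Y. d y x \<le> s" if x: "x \<in> X" for x
    proof -
      obtain y where y: "y \<in> Y" "h y = h x" using x hY by (metis imageE imageI)
      then have "d' (h y) (h x) \<le> 0" using hX x by auto
      with s y x YX show ?thesis by blast
    qed
    then show "\<exists>r. \<forall>x\<in>X. \<exists>y\<in>Y. d y x \<le> r" by blast
  qed (fact YX)
  moreover have "coarse_large X' (metric_coarse X' d') (h ` X)"
    unfolding X'.coarse_large_metric using hX dense by (intro conjI exI[of _ c]) auto
  moreover have "asymorphism Y (coarse_subspace (metric_coarse X d) Y)
      (h ` X) (coarse_subspace (metric_coarse X' d') (h ` X)) h"
    unfolding X.coarse_subspace_metric[OF YX] X'.coarse_subspace_metric[OF hX] asymorphism_def macro_uniform_metric[OF MY MhX] macro_uniform_metric[OF MhX MY]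
  proof (intro conjI)
    show "controlled Y d (\<lambda>x y. d' (h x) (h y))"
      using up YX unfolding controlled_def by (meson subsetD)
    have "controlled Y (\<lambda>x y. d' (h x) (h y)) d"
      using down YX unfolding controlled_def by (meson subsetD)
    moreover have "inv_into Y h z \<in> Y" "h (inv_into Y h z) = z" if "z \<in> h ` X" for z
      using that hY by (metis inv_into_into) (use that hY in \<open>metis f_inv_into_f\<close>)
    ultimately show "controlled (h ` X) d' (\<lambda>x y. d (inv_into Y h x) (inv_into Y h y))"
      unfolding controlled_def by metis
    show "inv_into Y h ` h ` X \<subseteq> Y" using hY by (metis image_subsetI inv_into_into)
  qed (use bij hY in auto)
  ultimately show ?thesis
    unfolding coarsely_equivalent_def by blast
qed

text \<open>
  Moving each point to a nearby point of the large subspace changes distances by a bounded amount;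
  afterwards the asymorphism can be applied.
\<close>

lemma coarse_embedding_if_coarsely_equivalent:
  assumes X: "Metric_space X d" and X': "Metric_space X' d'"
    and eq: "coarsely_equivalent X (metric_coarse X d) X' (metric_coarse X' d')"
  shows "\<exists>g. coarse_embedding X d X' d' g"
proof -
  interpret X: Metric_space X d by fact
  interpret X': Metric_space X' d' by fact
  obtain Y Y' f where L: "coarse_large X (metric_coarse X d) Y" "coarse_large X' (metric_coarse X' d') Y'"
    and a: "asymorphism Y (coarse_subspace (metric_coarse X d) Y) Y' (coarse_subspace (metric_coarse X' d') Y') f"
    using eq unfolding coarsely_equivalent_def by blast
  have YX: "Y \<subseteq> X" and YX': "Y' \<subseteq> X'" using L unfolding coarse_large_def by auto
  note MY = X.subspace[OF YX] and MY' = X'.subspace[OF YX']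
  have bij: "bij_betw f Y Y'" and up: "controlled Y d (\<lambda>x y. d' (f x) (f y))"
    and down: "controlled Y' d' (\<lambda>x y. d (inv_into Y f x) (inv_into Y f y))"
    using a unfolding asymorphism_def X.coarse_subspace_metric[OF YX] X'.coarse_subspace_metric[OF YX']
      macro_uniform_metric[OF MY MY'] macro_uniform_metric[OF MY' MY] by auto
  obtain c where "\<forall>x\<in>X. \<exists>y\<in>Y. d y x \<le> c" using L(1) unfolding X.coarse_large_metric by blast
  then obtain q where q: "\<And>x. x \<in> X \<Longrightarrow> q x \<in> Y" "\<And>x. x \<in> X \<Longrightarrow> d (q x) x \<le> c" by metis
  have qX: "q x \<in> X" if "x \<in> X" for x using q(1)[OF that] YX by blast
  have fq: "f (q x) \<in> Y'" "inv_into Y f (f (q x)) = q x" if "x \<in> X" for x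
    using bij q(1)[OF that] by (auto simp: bij_betw_def)
  have d_q: "d (q x) (q y) \<le> d x y + 2 * c" and q_d: "d x y \<le> d (q x) (q y) + 2 * c"
    if xy: "x \<in> X" "y \<in> X" for x y
  proof -
    have "d (q x) (q y) \<le> d (q x) x + d x (q y)" "d x (q y) \<le> d x y + d y (q y)"
      "d x y \<le> d x (q x) + d (q x) y" "d (q x) y \<le> d (q x) (q y) + d (q y) y"
      using qX xy by (simp_all add: X.triangle)
    then show "d (q x) (q y) \<le> d x y + 2 * c" "d x y \<le> d (q x) (q y) + 2 * c"
      using q(2)[OF xy(1)] q(2)[OF xy(2)] X.commute[of "q x" x] X.commute[of "q y" y] by linarith+
  qed
  have "coarse_embedding X d X' d' (f \<circ> q)"
    unfolding coarse_embedding_def controlled_def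
  proof (intro conjI allI)
    show "(f \<circ> q) ` X \<subseteq> X'" using fq(1) subsetD[OF YX'] by (simp add: image_subset_iff)
    fix r
    obtain s where s: "\<forall>x\<in>Y. \<forall>y\<in>Y. d x y \<le> r + 2 * c \<longrightarrow> d' (f x) (f y) \<le> s"
      using controlledD[OF up, of "r + 2 * c"] by (rule exE)
    have "d' ((f \<circ> q) x) ((f \<circ> q) y) \<le> s" if "x \<in> X" "y \<in> X" "d x y \<le> r" for x y
      using s q(1)[OF that(1)] q(1)[OF that(2)] d_q[OF that(1,2)] that(3) by simp
    then show "\<exists>s. \<forall>x\<in>X. \<forall>y\<in>X. d x y \<le> r \<longrightarrow> d' ((f \<circ> q) x) ((f \<circ> q) y) \<le> s" by blast
    obtain t where t: "\<forall>x\<in>Y'. \<forall>y\<in>Y'. d' x y \<le> r \<longrightarrow>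
        d (inv_into Y f x) (inv_into Y f y) \<le> t"
      using controlledD[OF down, of r] by (rule exE)
    have "d x y \<le> t + 2 * c" if "x \<in> X" "y \<in> X" "d' ((f \<circ> q) x) ((f \<circ> q) y) \<le> r" for x y
      using bspec[OF bspec[OF t fq(1)[OF that(1)]] fq(1)[OF that(2)]] fq(2)[OF that(1)] fq(2)[OF that(2)]
        that(3) q_d[OF that(1,2)] by simp
    then show "\<exists>s. \<forall>x\<in>X. \<forall>y\<in>X. d' ((f \<circ> q) x) ((f \<circ> q) y) \<le> r \<longrightarrow> d x y \<le> s" by blast
  qed
  then show ?thesis by blast
qed

section \<open>Selecting the leftmost point\<close>

text \<open>
  If two sets are within Hausdorff distance \<open>r\<close>, their images in the integers are within some
  \<open>s\<close> of each other, and then so are the minima of these images. As the map is a coarse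
  embedding, points where the minima are attained are close as well.
\<close>

lemma bornologous_selector_if_coarse_embedding_int:
  fixes g :: "'a \<Rightarrow> int"
  assumes X: "Metric_space X d"
    and g: "coarse_embedding X d UNIV (\<lambda>a b. real_of_int \<bar>a - b\<bar>) g"
  shows "\<exists>f. bornologous_selector X (metric_coarse X d) f"
proof -
  interpret Metric_space X d by fact
  have up: "controlled X d (\<lambda>x y. \<bar>g x - g y\<bar>)" and down: "controlled X (\<lambda>x y. \<bar>g x - g y\<bar>) d"
    using g unfolding coarse_embedding_def by auto
  define \<F> where "\<F> = {A. coarse_bounded X (metric_coarse X d) A} - {{}}"
  define f where "f A = (SOME a. a \<in> A \<and> (\<forall>b\<in>A. g a \<le> g b))" for A
  have f: "f A \<in> A \<and> (\<forall>b\<in>A. g (f A) \<le> g b)" if A: "A \<in> \<F>" for A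
  proof -
    obtain x r where x: "A \<subseteq> X" "A \<noteq> {}" "x \<in> X" "\<And>a. a \<in> A \<Longrightarrow> d x a \<le> r"
      using A unfolding \<F>_def coarse_bounded_metric by blast
    obtain s where s: "\<forall>y\<in>X. \<forall>z\<in>X. d y z \<le> r \<longrightarrow> real_of_int \<bar>g y - g z\<bar> \<le> s"
      using controlledD[OF up, of r] by (rule exE)
    have "g ` A \<subseteq> {g x - \<lceil>s\<rceil> .. g x + \<lceil>s\<rceil>}"
    proof
      fix z assume "z \<in> g ` A"
      then obtain a where "a \<in> A" "z = g a" by blast
      then have "real_of_int \<bar>g x - z\<bar> \<le> s" using s x by blast
      then have "\<bar>g x - z\<bar> \<le> \<lceil>s\<rceil>" by linarith
      then show "z \<in> {g x - \<lceil>s\<rceil> .. g x + \<lceil>s\<rceil>}" by auto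
    qed
    then have fin: "finite (g ` A)" by (rule finite_subset) simp
    then have "Min (g ` A) \<in> g ` A" using x(2) by (intro Min_in) simp_all
    then obtain a where "a \<in> A" "Min (g ` A) = g a" by (rule imageE)
    then have "a \<in> A \<and> (\<forall>b\<in>A. g a \<le> g b)" using Min_le[OF fin] by (metis imageI)
    then have "\<exists>a. a \<in> A \<and> (\<forall>b\<in>A. g a \<le> g b)" by (rule exI)
    then show ?thesis unfolding f_def by (rule someI_ex)
  qed
  have "coarse_selector X (metric_coarse X d) \<F> f"
    unfolding coarse_selector_metric[OF X]
  proof (intro conjI allI)
    show sub: "\<F> \<subseteq> nonempty_subsets X"
      unfolding \<F>_def nonempty_subsets_def coarse_bounded_def by auto
    show "\<forall>A\<in>\<F>. f A \<in> A" using f by blast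
    fix r
    obtain s where s: "\<forall>y\<in>X. \<forall>z\<in>X. d y z \<le> r \<longrightarrow> real_of_int \<bar>g y - g z\<bar> \<le> s"
      using controlledD[OF up, of r] by (rule exE)
    obtain t where t: "\<forall>y\<in>X. \<forall>z\<in>X. real_of_int \<bar>g y - g z\<bar> \<le> s \<longrightarrow> d y z \<le> t"
      using controlledD[OF down, of s] by (rule exE)
    have "d (f A) (f B) \<le> t" if A: "A \<in> \<F>" and B: "B \<in> \<F>" and AB: "hausdorff_close d r A B" for A B
    proof -
      have "A \<subseteq> X" "B \<subseteq> X" using sub A B unfolding nonempty_subsets_def by auto
      note X_in = subsetD[OF this(1)] subsetD[OF this(2)]
      obtain b where b: "b \<in> B" "d b (f A) \<le> r" using AB f[OF A] unfolding hausdorff_close_def by blast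
      obtain a where a: "a \<in> A" "d a (f B) \<le> r" using AB f[OF B] unfolding hausdorff_close_def by blast
      have fX: "f A \<in> X" "f B \<in> X" using f[OF A] f[OF B] X_in by simp_all
      have "real_of_int \<bar>g b - g (f A)\<bar> \<le> s" using s X_in(2)[OF b(1)] fX(1) b(2) by simp
      moreover have "real_of_int \<bar>g a - g (f B)\<bar> \<le> s" using s X_in(1)[OF a(1)] fX(2) a(2) by simp
      moreover have "g (f B) \<le> g b" "g (f A) \<le> g a" using f[OF A] f[OF B] a b by auto
      ultimately have "real_of_int \<bar>g (f A) - g (f B)\<bar> \<le> s" by linarith
      then show ?thesis using t fX by simp
    qed
    then show "\<exists>s. \<forall>A\<in>\<F>. \<forall>B\<in>\<F>. hausdorff_close d r A B \<longrightarrow> d (f A) (f B) \<le> s" by blast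
  qed
  then show ?thesis unfolding bornologous_selector_def \<F>_def by blast
qed

lemma two_selector_if_bornologous_selector:
  assumes X: "Metric_space X d" and f: "bornologous_selector X (metric_coarse X d) f"
  shows "two_selector X (metric_coarse X d) f"
proof -
  interpret Metric_space X d by fact
  have "{A. A \<subseteq> X \<and> card A = 2} \<subseteq> {A. coarse_bounded X (metric_coarse X d) A} - {{}}"
  proof
    fix A assume A: "A \<in> {A. A \<subseteq> X \<and> card A = 2}"
    then obtain a b where ab: "A = {a, b}" by (auto simp: card_2_iff)
    have "\<forall>y\<in>A. d a y \<le> max (d a a) (d a b)" unfolding ab by auto
    then show "A \<in> {A. coarse_bounded X (metric_coarse X d) A} - {{}}"
      unfolding coarse_bounded_metric using A ab by blast
  qed
  then show ?thesis
    using f unfolding two_selector_def bornologous_selector_def coarse_selector_metric[OF X]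
    by (meson subset_iff)
qed

section \<open>Paths and geodesics\<close>

lemma path_dist_attained:
  assumes "connected_graph V A" "x \<in> V" "y \<in> V"
  shows "\<exists>n. path_dist A x y = real n \<and> (x, y) \<in> A ^^ n"
  using connected_graph_relpow[OF assms] unfolding path_dist_def by (metis LeastI_ex)

lemma geodesic_exists:
  assumes G: "connected_graph V A" and xy: "x \<in> V" "y \<in> V"
  obtains p n where "p 0 = x" "p n = y" "path_dist A x y = real n"
    "\<And>i. i < n \<Longrightarrow> (p i, p (Suc i)) \<in> A" "\<And>i. i \<le> n \<Longrightarrow> p i \<in> V"
    "\<And>i. i \<le> n \<Longrightarrow> path_dist A x (p i) = real i"
    "\<And>i. i \<le> n \<Longrightarrow> path_dist A (p i) y = real n - real i"
proof -
  interpret Metric_space V "path_dist A" by (rule Metric_space_path_dist[OF G])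
  obtain n where n: "path_dist A x y = real n" "(x, y) \<in> A ^^ n"
    using path_dist_attained[OF G xy] by blast
  obtain p where p: "p 0 = x" "p n = y" "\<And>i. i < n \<Longrightarrow> (p i, p (Suc i)) \<in> A"
    using n(2) unfolding relpow_fun_conv by blast
  have pV: "p i \<in> V" if "i \<le> n" for i
  proof (cases i)
    case 0
    then show ?thesis using p(1) xy by simp
  next
    case (Suc j)
    then have "(p j, p i) \<in> A" using p(3)[of j] that by simp
    then show ?thesis using G unfolding connected_graph_def simple_graph_def by blast
  qed
  have seg: "(p i, p (i + k)) \<in> A ^^ k" if "i + k \<le> n" for i k
    unfolding relpow_fun_conv by (rule exI[of _ "\<lambda>j. p (i + j)"]) (use p(3) that in auto)
  have "path_dist A x (p i) = real i \<and> path_dist A (p i) y = real n - real i" if i: "i \<le> n" for i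
  proof -
    have "path_dist A x (p i) \<le> real i" "path_dist A (p i) y \<le> real (n - i)"
      using path_dist_le[OF seg[of 0 i]] path_dist_le[OF seg[of i "n - i"]] i p(1,2) by auto
    moreover have "real n \<le> path_dist A x (p i) + path_dist A (p i) y"
      using triangle[OF xy(1) pV[OF i] xy(2)] n(1) by simp
    ultimately show ?thesis using i by (simp add: of_nat_diff)
  qed
  then show thesis using that p n(1) pV by blast
qed

lemma discrete_intermediate_value:
  fixes u :: "nat \<Rightarrow> int"
  assumes "0 \<le> c" "u 0 \<le> z" "z \<le> u n" and "\<And>i. i < n \<Longrightarrow> \<bar>u (Suc i) - u i\<bar> \<le> c"
  shows "\<exists>i\<le>n. \<bar>u i - z\<bar> \<le> c"
  using assms
proof (induction n)
  case 0
  then show ?case by auto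
next
  case (Suc n)
  show ?case
  proof (cases "z \<le> u n")
    case True
    then show ?thesis using Suc by (meson le_SucI less_SucI)
  next
    case False
    moreover have "\<bar>u (Suc n) - u n\<bar> \<le> c" using Suc.prems(4) by blast
    ultimately have "\<bar>u n - z\<bar> \<le> c" using Suc.prems(3) by linarith
    then show ?thesis by (meson le_Suc_eq order_refl)
  qed
qed

lemma path_dist_int_line: "path_dist int_line a b = real_of_int \<bar>a - b\<bar>"
proof (rule antisym)
  interpret Metric_space UNIV "path_dist int_line"
    by (rule Metric_space_path_dist[OF connected_graph_int_line])
  have up: "(a, a + int n) \<in> int_line ^^ n" for a n
    by (induction n) (auto simp: int_line_def)
  have le: "path_dist int_line a b \<le> real_of_int (b - a)" if "a \<le> b" for a b
    using path_dist_le[OF up[of a "nat (b - a)"]] that by simp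
  show "path_dist int_line a b \<le> real_of_int \<bar>a - b\<bar>"
    using le[of a b] le[of b a] commute[of a b] by (cases "a \<le> b") auto
  have "\<bar>a - b\<bar> \<le> int n" if "(a, b) \<in> int_line ^^ n" for n
    using that by (induction n arbitrary: b) (fastforce simp: int_line_def)+
  then show "real_of_int \<bar>a - b\<bar> \<le> path_dist int_line a b"
    using path_dist_attained[OF connected_graph_int_line, of a b] by (metis UNIV_I of_int_le_iff of_int_of_nat_eq)
qed

lemma path_dist_nat_line: "path_dist nat_line a b = \<bar>real a - real b\<bar>"
proof (rule antisym)
  interpret Metric_space UNIV "path_dist nat_line"
    by (rule Metric_space_path_dist[OF connected_graph_nat_line])
  have up: "(a, a + n) \<in> nat_line ^^ n" for a n
    by (induction n) (auto simp: nat_line_def)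
  have le: "path_dist nat_line a b \<le> real b - real a" if "a \<le> b" for a b
    using path_dist_le[OF up[of a "b - a"]] that by simp
  show "path_dist nat_line a b \<le> \<bar>real a - real b\<bar>"
    using le[of a b] le[of b a] commute[of a b] by (cases "a \<le> b") auto
  have "\<bar>real a - real b\<bar> \<le> real n" if "(a, b) \<in> nat_line ^^ n" for n
    using that by (induction n arbitrary: b) (fastforce simp: nat_line_def)+
  then show "\<bar>real a - real b\<bar> \<le> path_dist nat_line a b"
    using path_dist_attained[OF connected_graph_nat_line, of a b] by (metis UNIV_I)
qed

section \<open>A 2-selector orders distant pairs consistently\<close>

lemma two_selector_mem:
  assumes f: "two_selector X \<E> f" and xy: "x \<in> X" "y \<in> X" "x \<noteq> y"
  shows "f {x, y} \<in> {x, y}"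
proof -
  have "\<forall>S\<in>{S. S \<subseteq> X \<and> card S = 2}. f S \<in> S"
    using f unfolding two_selector_def coarse_selector_def by blast
  moreover have "{x, y} \<in> {S. S \<subseteq> X \<and> card S = 2}" using xy by simp
  ultimately show ?thesis by (rule bspec)
qed

text \<open>
  Read \<open>f {a, y} = y\<close> as \<open>a\<close> preceding \<open>y\<close>. When \<open>a\<close> moves along an edge, the pair
  \<open>{a, y}\<close> moves by at most \<open>1\<close>, so its selected point moves by at most some constant \<open>K\<close>;
  a selection switching from \<open>y\<close> to \<open>a\<close> would jump by more than \<open>K\<close> if \<open>a\<close> and \<open>y\<close> are further
  apart than \<open>K\<close>. Hence the order of two points never changes along a path that keeps them at
  distance more than \<open>K\<close>.
\<close>

lemma two_selector_stable_on_far_pairs: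
  assumes G: "connected_graph V A" and f: "two_selector V (graph_coarse V A) f"
  shows "\<exists>K :: nat. \<forall>p n y. y \<in> V \<longrightarrow> (\<forall>i<n. (p i, p (Suc i)) \<in> A) \<longrightarrow>
    (\<forall>i\<le>n. p i \<in> V \<and> path_dist A (p i) y > real K) \<longrightarrow> (f {p 0, y} = y \<longleftrightarrow> f {p n, y} = y)"
proof -
  interpret Metric_space V "path_dist A" by (rule Metric_space_path_dist[OF G])
  have "\<exists>s. \<forall>S\<in>{S. S \<subseteq> V \<and> card S = 2}. \<forall>T\<in>{S. S \<subseteq> V \<and> card S = 2}.
      hausdorff_close (path_dist A) 1 S T \<longrightarrow> path_dist A (f S) (f T) \<le> s"
    using f unfolding two_selector_def graph_coarse_def
      coarse_selector_metric[OF Metric_space_path_dist[OF G]] by blast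
  then obtain s where s: "\<And>S T. S \<subseteq> V \<Longrightarrow> card S = 2 \<Longrightarrow> T \<subseteq> V \<Longrightarrow> card T = 2 \<Longrightarrow>
      hausdorff_close (path_dist A) 1 S T \<Longrightarrow> path_dist A (f S) (f T) \<le> s" by blast
  obtain K where K: "s \<le> real K" using real_arch_simple by blast
  have step: "f {b, y} = y"
    if ab: "(a, b) \<in> A \<or> (b, a) \<in> A" and V: "a \<in> V" "b \<in> V" "y \<in> V"
      and far: "path_dist A a y > real K" "path_dist A b y > real K" and fa: "f {a, y} = y" for a b y
  proof -
    have "a \<noteq> y" "b \<noteq> y" using far V by auto
    then have c2: "card {a, y} = 2" "card {b, y} = 2" by auto
    have "path_dist A a b \<le> 1"
      using ab path_dist_le[of a b 1 A] path_dist_le[of b a 1 A] commute[of a b] by auto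
    then have "hausdorff_close (path_dist A) 1 {a, y} {b, y}"
      unfolding hausdorff_close_def using V commute[of a b] by auto
    then have "path_dist A (f {a, y}) (f {b, y}) \<le> s" using s c2 V by simp
    moreover have "f {b, y} \<noteq> b"
    proof
      assume "f {b, y} = b"
      then have "path_dist A y b \<le> s" using calculation fa by simp
      then show False using K far commute[of y b] by linarith
    qed
    moreover have "f {b, y} \<in> {b, y}" using two_selector_mem[OF f] V \<open>b \<noteq> y\<close> by simp
    ultimately show ?thesis by blast
  qed
  have "f {p 0, y} = y \<longleftrightarrow> f {p n, y} = y"
    if "y \<in> V" "\<forall>i<n. (p i, p (Suc i)) \<in> A" "\<forall>i\<le>n. p i \<in> V \<and> path_dist A (p i) y > real K" for p n y
    using that
  proof (induction n)
    case (Suc n)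
    have edge: "(p n, p (Suc n)) \<in> A" using Suc.prems(2) by simp
    have pV: "p n \<in> V" "p (Suc n) \<in> V"
      and far: "path_dist A (p n) y > real K" "path_dist A (p (Suc n)) y > real K"
      using Suc.prems(3) by simp_all
    have "f {p n, y} = y \<longleftrightarrow> f {p (Suc n), y} = y"
      using step[OF disjI1[OF edge] pV Suc.prems(1) far]
        step[OF disjI2[OF edge] pV(2,1) Suc.prems(1) far(2,1)] by (rule iffI)
    moreover have "f {p 0, y} = y \<longleftrightarrow> f {p n, y} = y"
      by (rule Suc.IH) (use Suc.prems in simp_all)
    ultimately show ?case by (rule trans[rotated])
  qed simp
  then show ?thesis by blast
qed

text \<open>
  The value at \<open>w\<close> itself is \<open>0\<close>, whatever \<open>f {w}\<close> is. The floor turns the real-valued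
  path distance, which is a natural number, into an integer.
\<close>

definition signed_dist :: "('a \<times> 'a) set \<Rightarrow> ('a set \<Rightarrow> 'a) \<Rightarrow> 'a \<Rightarrow> 'a \<Rightarrow> int" where
  "signed_dist A f w x = (if f {w, x} = x then 1 else - 1) * \<lfloor>path_dist A w x\<rfloor>"

lemma abs_signed_dist: "real_of_int \<bar>signed_dist A f w x\<bar> = path_dist A w x"
  unfolding signed_dist_def path_dist_def by simp

text \<open>
  For equal signs the upper bound on the distance uses that far-apart points cannot exchange
  their order; for opposite signs the lower bound uses that the sign can only change near \<open>w\<close>.
  The remaining two bounds are triangle inequalities.
\<close>

lemma signed_dist_quasi_isometric:
  assumes G: "connected_graph V A" and f: "two_selector V (graph_coarse V A) f" and w: "w \<in> V"
  obtains c :: nat where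
    "\<And>x y. x \<in> V \<Longrightarrow> y \<in> V \<Longrightarrow>
       \<bar>real_of_int (signed_dist A f w x) - real_of_int (signed_dist A f w y)\<bar> \<le> path_dist A x y + real c"
    "\<And>x y. x \<in> V \<Longrightarrow> y \<in> V \<Longrightarrow>
       path_dist A x y \<le> \<bar>real_of_int (signed_dist A f w x) - real_of_int (signed_dist A f w y)\<bar> + real c"
proof -
  interpret Metric_space V "path_dist A" by (rule Metric_space_path_dist[OF G])
  let ?d = "path_dist A"
  let ?h = "\<lambda>x. real_of_int (signed_dist A f w x)"
  obtain K :: nat where K: "\<forall>p n y. y \<in> V \<longrightarrow> (\<forall>i<n. (p i, p (Suc i)) \<in> A) \<longrightarrow>
    (\<forall>i\<le>n. p i \<in> V \<and> ?d (p i) y > real K) \<longrightarrow> (f {p 0, y} = y \<longleftrightarrow> f {p n, y} = y)"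
    using two_selector_stable_on_far_pairs[OF G f] by (rule exE)
  have sel: "f {x, y} = x \<or> f {x, y} = y" if "x \<in> V" "y \<in> V" "x \<noteq> y" for x y
    using two_selector_mem[OF f that] by blast
  have h: "?h x = (if f {w, x} = x then ?d w x else - ?d w x)" for x
    unfolding signed_dist_def path_dist_def by simp
  have upper: "?d x y \<le> \<bar>?d w x - ?d w y\<bar> + 2 * real K"
    if V: "x \<in> V" "y \<in> V" and same: "f {w, x} = x \<longleftrightarrow> f {w, y} = y" for x y
  proof (rule ccontr)
    assume far: "\<not> ?thesis"
    \<comment> \<open>While \<open>p i\<close> travels from \<open>w\<close> to \<open>a\<close>, its distance to \<open>b\<close> is at least
      \<open>d w b - i\<close> and at least \<open>d a b - (d w a - i)\<close>. These two bounds have a sum that is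
      independent of \<open>i\<close> and exceeds \<open>2 * K\<close>, so one of them exceeds \<open>K\<close>.\<close>
    have transport: "f {w, b} = b \<longleftrightarrow> f {a, b} = b"
      if ab: "a \<in> V" "b \<in> V" and far: "?d a b > \<bar>?d w a - ?d w b\<bar> + 2 * real K" for a b
    proof -
      obtain p n where p: "p 0 = w" "p n = a" "?d w a = real n"
        "\<And>i. i < n \<Longrightarrow> (p i, p (Suc i)) \<in> A" "\<And>i. i \<le> n \<Longrightarrow> p i \<in> V"
        "\<And>i. i \<le> n \<Longrightarrow> ?d w (p i) = real i" "\<And>i. i \<le> n \<Longrightarrow> ?d (p i) a = real n - real i"
        using geodesic_exists[OF G w ab(1)] by metis
      have "?d (p i) b > real K" if i: "i \<le> n" for i
      proof -
        have "?d w b \<le> real i + ?d (p i) b" using triangle[OF w p(5)[OF i] ab(2)] p(6)[OF i] by simp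
        moreover have "?d a b \<le> (real n - real i) + ?d (p i) b"
          using triangle[OF ab(1) p(5)[OF i] ab(2)] p(7)[OF i] commute[of a "p i"] by simp
        ultimately show ?thesis using far p(3) by linarith
      qed
      then have "f {p 0, b} = b \<longleftrightarrow> f {p n, b} = b" using K p(4,5) ab(2) by simp
      then show ?thesis using p(1,2) by simp
    qed
    have "f {w, y} = y \<longleftrightarrow> f {x, y} = y" using transport[of x y] far V by simp
    moreover have "f {w, x} = x \<longleftrightarrow> f {x, y} = x"
      using transport[of y x] far V commute[of x y] by (simp add: insert_commute abs_minus_commute)
    moreover have "x \<noteq> y" using far V by auto
    ultimately show False using same sel[OF V] by metis
  qed
  have lower: "?d w x + ?d w y \<le> ?d x y + 2 * real K"
    if V: "x \<in> V" "y \<in> V" and opp: "(f {w, x} = x) \<noteq> (f {w, y} = y)" for x y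
  proof -
    obtain p n where p: "p 0 = x" "p n = y" "?d x y = real n"
      "\<And>i. i < n \<Longrightarrow> (p i, p (Suc i)) \<in> A" "\<And>i. i \<le> n \<Longrightarrow> p i \<in> V"
      "\<And>i. i \<le> n \<Longrightarrow> ?d x (p i) = real i" "\<And>i. i \<le> n \<Longrightarrow> ?d (p i) y = real n - real i"
      using geodesic_exists[OF G V] by metis
    have "\<exists>i\<le>n. ?d (p i) w \<le> real K"
    proof (rule ccontr)
      assume "\<not> ?thesis"
      then have far: "\<And>i. i \<le> n \<Longrightarrow> ?d (p i) w > real K" by force
      then have "f {p 0, w} = w \<longleftrightarrow> f {p n, w} = w" using K p(4,5) w by simp
      then have "f {w, x} = w \<longleftrightarrow> f {w, y} = w" using p(1,2) by (simp add: insert_commute)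
      moreover have "w \<noteq> x" "w \<noteq> y" using far[of 0] far[of n] p(1,2) V w by auto
      ultimately show False using sel[of w x] sel[of w y] V w opp by metis
    qed
    then obtain i where i: "i \<le> n" "?d (p i) w \<le> real K" by blast
    have "?d w x \<le> ?d w (p i) + real i"
      using triangle[OF w p(5)[OF i(1)] V(1)] p(6)[OF i(1)] commute[of x "p i"] by simp
    moreover have "?d w y \<le> ?d w (p i) + (real n - real i)"
      using triangle[OF w p(5)[OF i(1)] V(2)] p(7)[OF i(1)] by simp
    ultimately show ?thesis using i(2) p(3) commute[of w "p i"] by linarith
  qed
  have tri: "\<bar>?d w x - ?d w y\<bar> \<le> ?d x y" "?d x y \<le> ?d w x + ?d w y" if V: "x \<in> V" "y \<in> V" for x y
    using triangle[OF w V] triangle[OF w V(2,1)] triangle[OF V(1) w V(2)] commute[of x y] commute[of x w]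
    by linarith+
  have abs_sum: "\<bar>?d w x + ?d w y\<bar> = ?d w x + ?d w y" "\<bar>- ?d w x - ?d w y\<bar> = ?d w x + ?d w y" for x y
    using nonneg[of w x] nonneg[of w y] by linarith+
  show thesis
  proof (rule that[of "2 * K"])
    fix x y assume V: "x \<in> V" "y \<in> V"
    show "\<bar>?h x - ?h y\<bar> \<le> ?d x y + real (2 * K)"
    proof (cases "(f {w, x} = x) = (f {w, y} = y)")
      case True
      then have "\<bar>?h x - ?h y\<bar> = \<bar>?d w x - ?d w y\<bar>" unfolding h by auto
      then show ?thesis using tri(1)[OF V] by simp
    next
      case False
      then have "\<bar>?h x - ?h y\<bar> = ?d w x + ?d w y" unfolding h using abs_sum[of x y] by (cases "f {w, x} = x") simp_all
      then show ?thesis using lower[OF V False] by simp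
    qed
    show "?d x y \<le> \<bar>?h x - ?h y\<bar> + real (2 * K)"
    proof (cases "(f {w, x} = x) = (f {w, y} = y)")
      case True
      then have "\<bar>?h x - ?h y\<bar> = \<bar>?d w x - ?d w y\<bar>" unfolding h by auto
      then show ?thesis using upper[OF V True] by simp
    next
      case False
      then have "\<bar>?h x - ?h y\<bar> = ?d w x + ?d w y" unfolding h using abs_sum[of x y] by (cases "f {w, x} = x") simp_all
      then show ?thesis using tri(2)[OF V] by simp
    qed
  qed
qed

section \<open>Graphs with a 2-selector are coarsely intervals of the integers\<close>

text \<open>
  The distance from \<open>w\<close> takes every natural number as a value, since the points of a geodesic
  starting at \<open>w\<close> realise all smaller distances.
\<close>

lemma coarsely_nat_if_one_sided:
  assumes G: "connected_graph V A" and w: "w \<in> V"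
    and unb: "\<And>n. \<exists>x\<in>V. path_dist A w x > real n"
    and inj: "\<And>x y. x \<in> V \<Longrightarrow> y \<in> V \<Longrightarrow> path_dist A x y \<le> \<bar>path_dist A w x - path_dist A w y\<bar> + c"
  shows "coarsely_equivalent V (graph_coarse V A) (UNIV :: nat set) (graph_coarse UNIV nat_line)"
proof -
  let ?d = "path_dist A"
  note X = Metric_space_path_dist[OF G]
  interpret Metric_space V ?d by (rule X)
  define h where "h x = nat \<lfloor>?d w x\<rfloor>" for x
  have h: "real (h x) = ?d w x" for x unfolding h_def path_dist_def by simp
  have dh: "path_dist nat_line (h x) (h y) = \<bar>?d w x - ?d w y\<bar>" for x y
    unfolding path_dist_nat_line h by simp
  have "coarse_embedding V ?d UNIV (path_dist nat_line) h"
    unfolding coarse_embedding_def dh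
  proof (intro conjI)
    have "\<bar>?d w x - ?d w y\<bar> \<le> ?d x y + 0" if V: "x \<in> V" "y \<in> V" for x y
      using triangle[OF w V] triangle[OF w V(2,1)] commute[of x y] by linarith
    then show "controlled V ?d (\<lambda>x y. \<bar>?d w x - ?d w y\<bar>)" by (rule controlled_additive)
    show "controlled V (\<lambda>x y. \<bar>?d w x - ?d w y\<bar>) ?d" by (rule controlled_additive) (rule inj)
  qed simp
  moreover have "\<exists>x\<in>V. path_dist nat_line (h x) z \<le> 0" for z
  proof -
    obtain x where x: "x \<in> V" "?d w x > real z" using unb by blast
    obtain p n where p: "?d w x = real n" "\<And>i. i \<le> n \<Longrightarrow> p i \<in> V"
      "\<And>i. i \<le> n \<Longrightarrow> ?d w (p i) = real i"
      using geodesic_exists[OF G w x(1)] by metis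
    have "z \<le> n" using p(1) x(2) by simp
    then have "p z \<in> V" "real (h (p z)) = real z" using p(2,3) h by auto
    then show ?thesis unfolding path_dist_nat_line by (intro bexI[of _ "p z"]) auto
  qed
  ultimately show ?thesis
    unfolding graph_coarse_def
    by (intro coarsely_equivalent_if_dense_coarse_embedding[OF X Metric_space_path_dist[OF connected_graph_nat_line]])
qed

text \<open>
  Along an edge \<open>h\<close> changes by at most \<open>c + 1\<close>, so on a path from a point of small value to a
  point of large value it comes within \<open>c + 1\<close> of every integer in between.
\<close>

lemma coarsely_int_if_two_sided:
  fixes h :: "'a \<Rightarrow> int"
  assumes G: "connected_graph V A"
    and up: "\<And>x y. x \<in> V \<Longrightarrow> y \<in> V \<Longrightarrow> \<bar>real_of_int (h x) - real_of_int (h y)\<bar> \<le> path_dist A x y + real c"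
    and down: "\<And>x y. x \<in> V \<Longrightarrow> y \<in> V \<Longrightarrow> path_dist A x y \<le> \<bar>real_of_int (h x) - real_of_int (h y)\<bar> + real c"
    and above: "\<And>z. \<exists>x\<in>V. z \<le> h x" and below: "\<And>z. \<exists>x\<in>V. h x \<le> z"
  shows "coarsely_equivalent V (graph_coarse V A) (UNIV :: int set) (graph_coarse UNIV int_line)"
proof -
  let ?d = "path_dist A"
  note X = Metric_space_path_dist[OF G]
  have dh: "path_dist int_line (h x) (h y) = \<bar>real_of_int (h x) - real_of_int (h y)\<bar>" for x y
    unfolding path_dist_int_line by simp
  have "coarse_embedding V ?d UNIV (path_dist int_line) h"
    unfolding coarse_embedding_def dh
  proof (intro conjI)
    show "controlled V ?d (\<lambda>x y. \<bar>real_of_int (h x) - real_of_int (h y)\<bar>)"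
      by (rule controlled_additive) (rule up)
    show "controlled V (\<lambda>x y. \<bar>real_of_int (h x) - real_of_int (h y)\<bar>) ?d"
      by (rule controlled_additive) (rule down)
  qed simp
  moreover have "\<exists>x\<in>V. path_dist int_line (h x) z \<le> real (c + 1)" for z
  proof -
    obtain x y where xy: "x \<in> V" "y \<in> V" "h x \<le> z" "z \<le> h y" using above below by metis
    obtain p n where p: "p 0 = x" "p n = y"
      "\<And>i. i < n \<Longrightarrow> (p i, p (Suc i)) \<in> A" "\<And>i. i \<le> n \<Longrightarrow> p i \<in> V"
      using geodesic_exists[OF G xy(1,2)] by metis
    have "\<bar>h (p (Suc i)) - h (p i)\<bar> \<le> int (c + 1)" if i: "i < n" for i
    proof -
      have "?d (p i) (p (Suc i)) \<le> 1" using path_dist_le[of "p i" "p (Suc i)" 1 A] p(3)[OF i] by simp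
      then have "\<bar>real_of_int (h (p i)) - real_of_int (h (p (Suc i)))\<bar> \<le> 1 + real c"
        using up[OF p(4) p(4), of i "Suc i"] i by simp
      then show ?thesis by linarith
    qed
    then obtain i where i: "i \<le> n" "\<bar>h (p i) - z\<bar> \<le> int (c + 1)"
      using discrete_intermediate_value[of "int (c + 1)" "\<lambda>i. h (p i)" z n] xy p(1,2) by auto
    then have "path_dist int_line (h (p i)) z \<le> real (c + 1)"
      unfolding path_dist_int_line by linarith
    then show ?thesis using p(4)[OF i(1)] by blast
  qed
  ultimately show ?thesis
    unfolding graph_coarse_def
    by (intro coarsely_equivalent_if_dense_coarse_embedding[OF X Metric_space_path_dist[OF connected_graph_int_line]])
qed

lemma coarse_classification_if_two_selector:
  assumes G: "connected_graph V A" and f: "two_selector V (graph_coarse V A) f"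
  shows "coarse_bounded V (graph_coarse V A) V \<or>
    coarsely_equivalent V (graph_coarse V A) (UNIV :: nat set) (graph_coarse UNIV nat_line) \<or>
    coarsely_equivalent V (graph_coarse V A) (UNIV :: int set) (graph_coarse UNIV int_line)"
proof -
  let ?d = "path_dist A"
  interpret Metric_space V ?d by (rule Metric_space_path_dist[OF G])
  obtain w where w: "w \<in> V" using G unfolding connected_graph_def by blast
  define h where "h = signed_dist A f w"
  obtain c :: nat where
    up: "\<And>x y. x \<in> V \<Longrightarrow> y \<in> V \<Longrightarrow> \<bar>real_of_int (h x) - real_of_int (h y)\<bar> \<le> ?d x y + real c" and
    down: "\<And>x y. x \<in> V \<Longrightarrow> y \<in> V \<Longrightarrow> ?d x y \<le> \<bar>real_of_int (h x) - real_of_int (h y)\<bar> + real c"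
    using signed_dist_quasi_isometric[OF G f w] unfolding h_def by metis
  have abs_h: "\<bar>real_of_int (h x)\<bar> = ?d w x" for x
    using abs_signed_dist[of A f w x] unfolding h_def by simp
  \<comment> \<open>The sign \<open>\<sigma>\<close> lets one case treat both the map bounded below and the map bounded above.\<close>
  consider (bounded) N where "\<forall>x\<in>V. ?d w x \<le> real N"
    | (one_sided) M \<sigma> where "\<And>n. \<exists>x\<in>V. ?d w x > real n" "\<sigma> = 1 \<or> \<sigma> = - 1" "\<forall>x\<in>V. \<sigma> * h x \<ge> M"
    | (two_sided) "\<forall>z. \<exists>x\<in>V. z \<le> h x" "\<forall>z. \<exists>x\<in>V. h x \<le> z"
  proof -
    have "(\<exists>N. \<forall>x\<in>V. ?d w x \<le> real N) \<or> (\<forall>n. \<exists>x\<in>V. ?d w x > real n)" by (meson linorder_not_le)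
    moreover have "(\<forall>z. \<exists>x\<in>V. h x \<le> z) \<or> (\<exists>M. \<forall>x\<in>V. 1 * h x \<ge> M)"
      by (metis linorder_le_cases mult_1)
    moreover have "(\<forall>z. \<exists>x\<in>V. z \<le> h x) \<or> (\<exists>M. \<forall>x\<in>V. (- 1) * h x \<ge> M)"
      by (metis linorder_le_cases minus_le_iff mult_minus1 neg_le_iff_le)
    ultimately show thesis using that by metis
  qed
  then show ?thesis
  proof cases
    case bounded
    then show ?thesis unfolding graph_coarse_def coarse_bounded_metric using w by blast
  next
    case one_sided
    \<comment> \<open>As \<open>\<sigma> * h\<close> is bounded below by \<open>M\<close>, it differs from \<open>\<bar>h\<bar>\<close> by at most \<open>2 * \<bar>M\<bar>\<close> at
      each of the two points.\<close>
    have "?d x y \<le> \<bar>?d w x - ?d w y\<bar> + (real c + 4 * \<bar>real_of_int M\<bar>)" if V: "x \<in> V" "y \<in> V" for x y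
    proof -
      have "M \<le> \<sigma> * h x" "M \<le> \<sigma> * h y" using one_sided V by auto
      then have "\<bar>h x - h y\<bar> \<le> \<bar>\<bar>h x\<bar> - \<bar>h y\<bar>\<bar> + 4 * \<bar>M\<bar>" using one_sided(2) by auto
      then have "\<bar>real_of_int (h x) - real_of_int (h y)\<bar> \<le>
          \<bar>\<bar>real_of_int (h x)\<bar> - \<bar>real_of_int (h y)\<bar>\<bar> + 4 * \<bar>real_of_int M\<bar>" by linarith
      then show ?thesis using down[OF V] unfolding abs_h by linarith
    qed
    then show ?thesis using coarsely_nat_if_one_sided[OF G w one_sided(1)] by blast
  next
    case two_sided
    then show ?thesis using coarsely_int_if_two_sided[OF G up down] by blast
  qed
qed

lemma bornologous_selector_if_coarse_interval:
  assumes G: "connected_graph V A"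
    and "coarse_bounded V (graph_coarse V A) V \<or>
      coarsely_equivalent V (graph_coarse V A) (UNIV :: nat set) (graph_coarse UNIV nat_line) \<or>
      coarsely_equivalent V (graph_coarse V A) (UNIV :: int set) (graph_coarse UNIV int_line)"
  shows "\<exists>f. bornologous_selector V (graph_coarse V A) f"
proof -
  let ?d = "path_dist A" and ?e = "\<lambda>a b :: int. real_of_int \<bar>a - b\<bar>"
  note X = Metric_space_path_dist[OF G]
  interpret Metric_space V ?d by (rule X)
  from assms(2) have "\<exists>g. coarse_embedding V ?d UNIV ?e g"
  proof (elim disjE)
    assume "coarse_bounded V (graph_coarse V A) V"
    \<comment> \<open>A bounded space embeds coarsely into the integers by a constant map.\<close>
    then obtain w r where w: "w \<in> V" "\<forall>x\<in>V. ?d w x \<le> r"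
      unfolding graph_coarse_def coarse_bounded_metric by blast
    have "?d x y \<le> r + r" if V: "x \<in> V" "y \<in> V" for x y
    proof -
      have "?d w x \<le> r" "?d w y \<le> r" using w(2) V by simp_all
      then show ?thesis using triangle[OF V(1) w(1) V(2)] commute[of x w] by linarith
    qed
    then have "coarse_embedding V ?d UNIV ?e (\<lambda>_. 0)"
      unfolding coarse_embedding_def controlled_def by auto
    then show ?thesis by blast
  next
    assume "coarsely_equivalent V (graph_coarse V A) (UNIV :: nat set) (graph_coarse UNIV nat_line)"
    then obtain g where "coarse_embedding V ?d UNIV (path_dist nat_line) g"
      unfolding graph_coarse_def
      using coarse_embedding_if_coarsely_equivalent[OF X Metric_space_path_dist[OF connected_graph_nat_line]]
      by blast
    then have "coarse_embedding V ?d UNIV ?e (\<lambda>x. int (g x))"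
      unfolding coarse_embedding_def path_dist_nat_line by simp
    then show ?thesis by blast
  next
    assume "coarsely_equivalent V (graph_coarse V A) (UNIV :: int set) (graph_coarse UNIV int_line)"
    then obtain g where "coarse_embedding V ?d UNIV (path_dist int_line) g"
      unfolding graph_coarse_def
      using coarse_embedding_if_coarsely_equivalent[OF X Metric_space_path_dist[OF connected_graph_int_line]]
      by blast
    then have "coarse_embedding V ?d UNIV ?e g"
      unfolding coarse_embedding_def path_dist_int_line by simp
    then show ?thesis by blast
  qed
  then show ?thesis
    unfolding graph_coarse_def using bornologous_selector_if_coarse_embedding_int[OF X] by blast
qed

theorem theorem1:
  fixes V :: "'a set" and A :: "('a \<times> 'a) set"
  assumes "connected_graph V A"
  shows "((\<exists>f. bornologous_selector V (graph_coarse V A) f) \<longleftrightarrow>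
            (\<exists>f. two_selector V (graph_coarse V A) f)) \<and>
         ((\<exists>f. two_selector V (graph_coarse V A) f) \<longleftrightarrow>
            coarse_bounded V (graph_coarse V A) V \<or>
            coarsely_equivalent V (graph_coarse V A) (UNIV :: nat set) (graph_coarse UNIV nat_line) \<or>
            coarsely_equivalent V (graph_coarse V A) (UNIV :: int set) (graph_coarse UNIV int_line))"
proof (intro conjI iffI)
  let ?E = "graph_coarse V A"
  have restrict: "\<exists>f. two_selector V ?E f" if "\<exists>f. bornologous_selector V ?E f"
    using that two_selector_if_bornologous_selector[OF Metric_space_path_dist[OF assms]]
    unfolding graph_coarse_def by blast
  show classify: "coarse_bounded V ?E V \<or>
      coarsely_equivalent V ?E (UNIV :: nat set) (graph_coarse UNIV nat_line) \<or>
      coarsely_equivalent V ?E (UNIV :: int set) (graph_coarse UNIV int_line)"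
    if "\<exists>f. two_selector V ?E f"
    using that coarse_classification_if_two_selector[OF assms] by (elim exE)
  show "\<exists>f. two_selector V ?E f" if "\<exists>f. bornologous_selector V ?E f"
    by (rule restrict[OF that])
  show "\<exists>f. bornologous_selector V ?E f" if "\<exists>f. two_selector V ?E f"
    by (rule bornologous_selector_if_coarse_interval[OF assms classify[OF that]])
  show "\<exists>f. two_selector V ?E f" if "coarse_bounded V ?E V \<or>
      coarsely_equivalent V ?E (UNIV :: nat set) (graph_coarse UNIV nat_line) \<or>
      coarsely_equivalent V ?E (UNIV :: int set) (graph_coarse UNIV int_line)"
    by (rule restrict[OF bornologous_selector_if_coarse_interval[OF assms that]])
qed

end
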